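(* Let $n\ge 2$. The assignment $\mathfrak q_{[i,j]}\mapsto q_{[i,j]}$ $(1\le i<j\le n)$, where $q_{[i,j]}=q_{j-1}\,q_{j-i}\,q_{j-1}$ and $q_m=t_1(t_2t_1)(t_3t_2t_1)\cdots(t_mt_{m-1}\cdots t_1)$, defines a group homomorphism from the cactus group $\mathcal C_n$ to $\mathcal{BK}_n$.
   Context: Semistandard Young tableaux (SSYT) are fillings of Young diagrams of partitions (straight shapes) by positive integers, weakly increasing along rows and strictly increasing down columns. Bender-Knuth moves: for $i\ge1$, $t_i$ acts on an SSYT $T$ as follows. Consider only the boxes with entry $i$ or $i+1$. Each row of this skew tableau consists, from left to right, of $a$ entries $i$ lying directly above an $i+1$, then $b$ entries $i$ alone in their columns (among boxes with entry $i$ or $i+1$), then $c$ entries $i+1$ alone in their columns, then $d$ entries $i+1$ lying directly below an $i$. In every row, replace the $b$ free $i$'s followed by $c$ free $(i+1)$'s by $c$ $i$'s followed by $b$ $(i+1)$'s. All other entries are unchanged. Each $t_i$ is a shape-preserving involution on SSYT. The Berenstein-Kirillov group $\mathcal{BK}$ is the free group on $t_i$, $i\in\mathbb Z_{>0}$, modulo all relations satisfied by the $t_i$ acting on all SSYT of all partition shapes (equivalently, the group of permutations of the set of all SSYT generated by the Bender-Knuth moves). $\mathcal{BK}_n$ is its subgroup generated by $t_1,\dots,t_{n-1}$. The cactus group $\mathcal C_n$ is generated by $\mathfrak q_{[i,j]}$, $1\le i<j\le n$, subject to the relations: (1) $\mathfrak q_{[i,j]}^2=I$; (2) $\mathfrak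 q_{[i,j]}\mathfrak q_{[k,l]}=\mathfrak q_{[k,l]}\mathfrak q_{[i,j]}$ if $j<k$; (3) $\mathfrak q_{[i,j]}\mathfrak q_{[k,l]}\mathfrak q_{[i,j]}=\mathfrak q_{[i+j-l,\,i+j-k]}$ if $i\le k<l\le j$. *)

theory Defs
  imports "HOL-Algebra.Bij" "HOL-Algebra.Elementary_Groups"
begin

section \<open>Semistandard Young tableaux\<close>

definition is_partition :: "nat list \<Rightarrow> bool" where
  "is_partition lam \<longleftrightarrow> sorted_wrt (\<ge>) lam \<and> 0 \<notin> set lam"

definition young_diagram :: "nat list \<Rightarrow> (nat \<times> nat) set" where
  "young_diagram lam = {(r, c). r < length lam \<and> c < lam ! r}"

text \<open>A tableau is a function of the row and the column of a box, both counted from 0 and with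
  rows numbered downwards. It is 0 outside its diagram; as entries are positive, the function
  determines the shape.\<close>

type_synonym tableau = "nat \<Rightarrow> nat \<Rightarrow> nat"

definition ssyt_of_shape :: "nat list \<Rightarrow> tableau \<Rightarrow> bool" where
  "ssyt_of_shape lam T \<longleftrightarrow>
     (\<forall>r c. (r, c) \<in> young_diagram lam \<longrightarrow> T r c > 0) \<and>
     (\<forall>r c. (r, c) \<notin> young_diagram lam \<longrightarrow> T r c = 0) \<and>
     (\<forall>r c c'. c < c' \<and> (r, c') \<in> young_diagram lam \<longrightarrow> T r c \<le> T r c') \<and>
     (\<forall>r r' c. r < r' \<and> (r', c) \<in> young_diagram lam \<longrightarrow> T r c < T r' c)"

definition SSYT :: "tableau set" where
  "SSYT = {T. \<exists>lam. is_partition lam \<and> ssyt_of_shape lam T}"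

section \<open>The Berenstein-Kirillov group\<close>

text \<open>The box in row \<open>r\<close> and column \<open>c\<close> has entry \<open>i\<close> or \<open>i + 1\<close> and is the only such box
  in its column.\<close>

definition free_box :: "nat \<Rightarrow> tableau \<Rightarrow> nat \<Rightarrow> nat \<Rightarrow> bool" where
  "free_box i T r c \<longleftrightarrow>
     T r c \<in> {i, i + 1} \<and> (\<forall>r'. r' \<noteq> r \<longrightarrow> T r' c \<notin> {i, i + 1})"

text \<open>In a row with \<open>b\<close> free entries \<open>i\<close> and \<open>d\<close> free entries \<open>i + 1\<close>, the first \<open>d\<close> free boxes
  from the left receive \<open>i\<close> and the remaining \<open>b\<close> ones receive \<open>i + 1\<close>.\<close>

definition bender_knuth :: "nat \<Rightarrow> tableau \<Rightarrow> tableau" where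
  "bender_knuth i T = (\<lambda>r c.
     if free_box i T r c
     then if card {c'. c' < c \<and> free_box i T r c'} < card {c'. free_box i T r c' \<and> T r c' = i + 1}
          then i else i + 1
     else T r c)"

text \<open>Elements of \<open>BijGroup SSYT\<close> are required to be \<open>undefined\<close> outside \<open>SSYT\<close>.\<close>

definition bk_move :: "nat \<Rightarrow> tableau \<Rightarrow> tableau" where
  "bk_move i = restrict (bender_knuth i) SSYT"

text \<open>The quotient of the free group on the \<open>t\<^sub>i\<close> by all relations that hold for their action
  on \<open>SSYT\<close> is the image of that action, a group of permutations of \<open>SSYT\<close>. The product
  is composition, with the right factor acting first. (\<open>subgroup_generated\<close> intersects the given set
  with the carrier, which is harmless: every \<open>bk_move i\<close> with \<open>i \<ge> 1\<close> is an involution of \<open>SSYT\<close>.)\<close>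

definition BK :: "(tableau \<Rightarrow> tableau) monoid" where
  "BK = subgroup_generated (BijGroup SSYT) (bk_move ` {1..})"

definition BK_sub :: "nat \<Rightarrow> (tableau \<Rightarrow> tableau) monoid" where
  "BK_sub n = subgroup_generated BK (bk_move ` {1..n - 1})"

text \<open>\<open>bk_desc m\<close> is \<open>t\<^sub>m \<dots> t\<^sub>2 t\<^sub>1\<close>, and \<open>bk_q m\<close> is the product of \<open>bk_desc 1, \<dots>, bk_desc m\<close>
  in this order.\<close>

primrec bk_desc :: "nat \<Rightarrow> tableau \<Rightarrow> tableau" where
  "bk_desc 0 = \<one>\<^bsub>BK\<^esub>"
| "bk_desc (Suc m) = bk_move (Suc m) \<otimes>\<^bsub>BK\<^esub> bk_desc m"

primrec bk_q :: "nat \<Rightarrow> tableau \<Rightarrow> tableau" where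
  "bk_q 0 = \<one>\<^bsub>BK\<^esub>"
| "bk_q (Suc m) = bk_q m \<otimes>\<^bsub>BK\<^esub> bk_desc (Suc m)"

definition bk_q_interval :: "nat \<Rightarrow> nat \<Rightarrow> tableau \<Rightarrow> tableau" where
  "bk_q_interval i j = bk_q (j - 1) \<otimes>\<^bsub>BK\<^esub> bk_q (j - i) \<otimes>\<^bsub>BK\<^esub> bk_q (j - 1)"

section \<open>Groups given by generators and relations\<close>

text \<open>The letter \<open>(x, True)\<close> stands for the generator \<open>x\<close> and \<open>(x, False)\<close> for its inverse.\<close>

type_synonym 'g word = "('g \<times> bool) list"

definition words :: "'g set \<Rightarrow> 'g word set" where
  "words X = lists (X \<times> UNIV)"

inductive_set word_cong :: "'g set \<Rightarrow> ('g word \<times> 'g word) set \<Rightarrow> ('g word \<times> 'g word) set"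
  for X :: "'g set" and R :: "('g word \<times> 'g word) set" where
  refl: "u \<in> words X \<Longrightarrow> (u, u) \<in> word_cong X R"
| sym: "(u, v) \<in> word_cong X R \<Longrightarrow> (v, u) \<in> word_cong X R"
| trans: "(u, v) \<in> word_cong X R \<Longrightarrow> (v, w) \<in> word_cong X R \<Longrightarrow> (u, w) \<in> word_cong X R"
| cancel: "u \<in> words X \<Longrightarrow> v \<in> words X \<Longrightarrow> x \<in> X \<Longrightarrow>
    (u @ [(x, b), (x, \<not> b)] @ v, u @ v) \<in> word_cong X R"
| relation: "u \<in> words X \<Longrightarrow> v \<in> words X \<Longrightarrow> l \<in> words X \<Longrightarrow> r \<in> words X \<Longrightarrow> (l, r) \<in> R \<Longrightarrow>
    (u @ l @ v, u @ r @ v) \<in> word_cong X R"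

definition presented_group :: "'g set \<Rightarrow> ('g word \<times> 'g word) set \<Rightarrow> 'g word set monoid" where
  "presented_group X R =
     \<lparr>carrier = words X // word_cong X R,
      monoid.mult = (\<lambda>A B. \<Union>u\<in>A. \<Union>v\<in>B. word_cong X R `` {u @ v}),
      one = word_cong X R `` {[]}\<rparr>"

section \<open>The cactus group\<close>

definition cactus_gens :: "nat \<Rightarrow> (nat \<times> nat) set" where
  "cactus_gens n = {(i, j). 1 \<le> i \<and> i < j \<and> j \<le> n}"

definition cactus_letter :: "nat \<Rightarrow> nat \<Rightarrow> (nat \<times> nat) word" where
  "cactus_letter i j = [((i, j), True)]"

definition cactus_rels :: "nat \<Rightarrow> ((nat \<times> nat) word \<times> (nat \<times> nat) word) set" where
  "cactus_rels n =
     {(cactus_letter i j @ cactus_letter i j, []) | i j. (i, j) \<in> cactus_gens n} \<union>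
     {(cactus_letter i j @ cactus_letter k l, cactus_letter k l @ cactus_letter i j) | i j k l.
        (i, j) \<in> cactus_gens n \<and> (k, l) \<in> cactus_gens n \<and> j < k} \<union>
     {(cactus_letter i j @ cactus_letter k l @ cactus_letter i j,
       cactus_letter (i + j - l) (i + j - k)) | i j k l.
        (i, j) \<in> cactus_gens n \<and> (k, l) \<in> cactus_gens n \<and> i \<le> k \<and> l \<le> j}"

definition cactus_group :: "nat \<Rightarrow> (nat \<times> nat) word set monoid" where
  "cactus_group n = presented_group (cactus_gens n) (cactus_rels n)"

definition cactus_q :: "nat \<Rightarrow> nat \<Rightarrow> nat \<Rightarrow> (nat \<times> nat) word set" where
  "cactus_q n i j = word_cong (cactus_gens n) (cactus_rels n) `` {cactus_letter i j}"

end

(* A semistandard tableau is a chain of partitions, and t_i toggles the i-th partition of the chain by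
   a piecewise linear formula. Involutivity of the toggles and commutation of distant ones already
   give the relations (1) and (3): t_N ... t_1 conjugates q_[k+1,l+1] to q_[k,l] for l <= N.

   Relation (2) reduces to the commutation of t_m with q_[k,l] for m + 1 < k. With p = k - 1 and
   s = l - k, tableau switching W of the first p letters past the next s + 1 satisfies
   q_(l-1) = q_s W q_(p-1), so q_[k,l] = q_(p-1) W^-1 q_s W q_(p-1), and it suffices that W t_m W^-1
   commutes with q_s for m < p. The crystal raising operators commute with switching, hence with
   K = W t_m W^-1. A tableau and its evacuation lie below one highest weight tableau, which is
   determined by its weight and therefore fixed by K on the first s + 1 letters; as raising
   operators are injective, K fixes everything below it as well. *)

theory Submission
  imports Defs
begin

section \<open>Toggles of triangular arrays\<close>

text \<open>Toggles act on arbitrary integer arrays. There they are involutions and intertwine the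
  raising operators; interlacing enters when maxima have to exist and entries have to be counted.

  The obstacle is relation (2): \<open>W t_m W^-1\<close> is not a word in toggles far away from
  those of \<open>q_s\<close>, so no formal manipulation of toggles yields the commutation. What is
  known of this conjugate is its effect on the crystal of the first \<open>s + 1\<close> letters.
  Switching shifts the index of a raising operator from \<open>i + p\<close> to \<open>i\<close>,
  out of reach of \<open>t_m\<close> with \<open>m < p\<close>, and it shifts weights likewise. That
  the shape of the first \<open>s + 1\<close> letters is kept is not known in advance. Hence highest
  weight patterns are identified in two ways: by shape for a pattern and its evacuation, by weight
  for \<open>K H\<close> and \<open>H\<close>.\<close>

text \<open>In a pattern \<open>G\<close>, the partition \<open>G i\<close> is the shape of the entries at most \<open>i\<close>.\<close>

type_synonym pattern = "nat \<Rightarrow> nat \<Rightarrow> int"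

text \<open>If \<open>a\<close>, \<open>b\<close>, \<open>d\<close> interlace, part \<open>r\<close>
  of \<open>b\<close> can vary from \<open>max (d (r + 1)) (a r)\<close> to
  \<open>min (d r) (a (r - 1))\<close>, and the toggle reflects it in this interval. Part 0 has no
  part of \<open>a\<close> before it, so \<open>d 0\<close> alone bounds it from above.\<close>

definition toggle_row :: "(nat \<Rightarrow> int) \<Rightarrow> (nat \<Rightarrow> int) \<Rightarrow> (nat \<Rightarrow> int) \<Rightarrow> nat \<Rightarrow> int" where
  "toggle_row a b d r =
     (case r of 0 \<Rightarrow> d 0 | Suc s \<Rightarrow> min (d r) (a s)) + max (d (Suc r)) (a r) - b r"

definition toggle :: "nat \<Rightarrow> pattern \<Rightarrow> pattern" where
  "toggle i G = G(i := toggle_row (G (i - 1)) (G i) (G (Suc i)))"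

lemma toggle_row_toggle_row [simp]: "toggle_row a (toggle_row a b d) d = b"
  by (rule ext) (simp add: toggle_row_def)

lemma toggle_toggle [simp]: "0 < i \<Longrightarrow> toggle i (toggle i G) = G"
  by (cases i) (auto simp: toggle_def)

lemma toggle_eq_iff [simp]: "0 < i \<Longrightarrow> toggle i G = toggle i H \<longleftrightarrow> G = H"
  by (metis toggle_toggle)

lemma toggle_commute: "Suc i < j \<or> Suc j < i \<Longrightarrow> toggle i (toggle j G) = toggle j (toggle i G)"
  by (auto simp: toggle_def fun_eq_iff)

lemma toggle_other: "j \<noteq> i \<Longrightarrow> toggle i G j = G j"
  by (simp add: toggle_def)

definition overhang :: "(nat \<Rightarrow> int) \<Rightarrow> (nat \<Rightarrow> int) \<Rightarrow> nat \<Rightarrow> int" where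
  "overhang d a k = (case k of 0 \<Rightarrow> 0 | Suc s \<Rightarrow> max (d k - a s) 0)"

text \<open>The lower end for part \<open>r - 1\<close> and the upper end for part \<open>r\<close>
  are the max and the min of the same two numbers and add up to \<open>d r + a (r - 1)\<close>. The
  last max stays unpaired, and \<open>overhang\<close> is what it has beyond
  \<open>a (k - 1)\<close>.\<close>

lemma sum_toggle_row:
  "sum (toggle_row a b d) {..<k} = sum d {..<k} + sum a {..<k} - sum b {..<k} + overhang d a k"
proof (induction k)
  case (Suc k)
  then show ?case
    by (cases k) (auto simp: toggle_row_def overhang_def)
qed (simp add: overhang_def)

text \<open>For shapes \<open>a\<close>, \<open>b\<close>, \<open>d\<close> of the entries below \<open>i\<close>, at most \<open>i\<close> and at most \<open>i + 1\<close>, the number of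
  entries \<open>i + 1\<close> in rows up to \<open>r\<close> minus the number of entries \<open>i\<close> in rows above \<open>r\<close>. By the signature
  rule, the raising operator changes an \<open>i + 1\<close> into \<open>i\<close> in the first row where this is maximal.\<close>

definition excess :: "(nat \<Rightarrow> int) \<Rightarrow> (nat \<Rightarrow> int) \<Rightarrow> (nat \<Rightarrow> int) \<Rightarrow> nat \<Rightarrow> int" where
  "excess a b d r = sum d {..<Suc r} - sum b {..<Suc r} - sum b {..<r} + sum a {..<r}"

text \<open>Let \<open>a1\<close>, \<open>a\<close>, \<open>b\<close>, \<open>d\<close> be the rows
  \<open>i - 1\<close> to \<open>i + 2\<close>. Toggling row \<open>i\<close> and then row
  \<open>i + 1\<close> replaces the excess for the letters \<open>i + 1\<close>,
  \<open>i + 2\<close> by that for \<open>i\<close>, \<open>i + 1\<close>. The difference consists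
  of two overhangs; the one of \<open>d\<close> over \<open>b1\<close>, with \<open>b1 r\<close>
  written out, yields the outer max.\<close>

lemma excess_toggle_row:
  fixes a a1 b d :: "nat \<Rightarrow> int"
  defines "b1 \<equiv> toggle_row a1 a b"
  shows "excess a1 b1 (toggle_row b1 b d) r =
    max (excess a b d (Suc r) - max (a1 r - b (Suc r)) 0) (excess a b d r - overhang b a1 r)"
proof -
  have 1: "excess a1 b1 (toggle_row b1 b d) r = excess a b d r + overhang d b1 (Suc r) - overhang b a1 r"
    unfolding excess_def by (simp only: sum_toggle_row b1_def)
  have "b1 r = sum b1 {..<Suc r} - sum b1 {..<r}"
    by simp
  also have "\<dots> = b r + a1 r - a r + overhang b a1 (Suc r) - overhang b a1 r"
    by (simp only: b1_def sum_toggle_row) simp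
  finally show ?thesis
    unfolding 1 by (simp add: excess_def overhang_def)
qed

definition raises_at :: "(nat \<Rightarrow> int) \<Rightarrow> (nat \<Rightarrow> int) \<Rightarrow> (nat \<Rightarrow> int) \<Rightarrow> nat \<Rightarrow> bool" where
  "raises_at a b d r \<longleftrightarrow> 0 < excess a b d r \<and> (\<forall>s<r. excess a b d s < excess a b d r) \<and>
     (\<forall>s. excess a b d s \<le> excess a b d r)"

lemma raises_at_unique: "raises_at a b d r \<Longrightarrow> raises_at a b d s \<Longrightarrow> r = s"
  unfolding raises_at_def by (metis linorder_neq_iff not_le)

lemma first_maximum_exists:
  fixes f :: "nat \<Rightarrow> int"
  assumes "\<And>r. f r \<le> C"
  shows "\<exists>r. (\<forall>s<r. f s < f r) \<and> (\<forall>s. f s \<le> f r)"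
proof -
  obtain r0 where r0: "\<And>s. nat (C - f r0) \<le> nat (C - f s)"
    using exists_least_iff[of "\<lambda>k. \<exists>r. k = nat (C - f r)"] by (metis linorder_not_le)
  then have max: "f s \<le> f r0" for s
    using assms[of s] assms[of r0] r0[of s] by linarith
  define r where "r = (LEAST r. \<forall>s. f s \<le> f r)"
  have "\<forall>s. f s \<le> f r"
    unfolding r_def by (rule LeastI[of _ r0]) (use max in auto)
  moreover have "f s < f r" if "s < r" for s
    using not_less_Least[OF that[unfolded r_def]] calculation by (metis order.trans not_le)
  ultimately show ?thesis by blast
qed

lemma raises_at_exists:
  assumes "\<And>s. excess a b d s \<le> C" and "0 < excess a b d s"
  shows "\<exists>r. raises_at a b d r"
  using first_maximum_exists[of "excess a b d" C] assms unfolding raises_at_def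
  by (metis order.strict_trans2)

text \<open>By \<open>excess_toggle_row\<close> the maximum of the excess is kept, and its first position either stays or
  moves up by one row, exactly as the cell added to the toggled partition does.\<close>

lemma raises_at_toggle_row:
  fixes a a1 b d :: "nat \<Rightarrow> int"
  defines "b1 \<equiv> toggle_row a1 a b"
  defines "d1 \<equiv> toggle_row b1 b d"
  assumes r: "raises_at a b d r"
  defines "b' \<equiv> b(r := b r + 1)"
  defines "b1' \<equiv> toggle_row a1 a b'"
  shows "\<exists>r'. raises_at a1 b1 d1 r' \<and> b1' = b1(r' := b1 r' + 1) \<and> toggle_row b1' b' d = d1"
proof -
  define F where "F = excess a b d"
  define F1 where "F1 = excess a1 b1 d1"
  have F1: "F1 s = max (F (Suc s) - max (a1 s - b (Suc s)) 0) (F s - overhang b a1 s)" for s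
    unfolding F1_def d1_def b1_def F_def by (rule excess_toggle_row)
  have F: "0 < F r" "\<And>s. s < r \<Longrightarrow> F s < F r" "\<And>s. F s \<le> F r"
    using r unfolding raises_at_def F_def by auto
  have ov: "0 \<le> overhang b a1 s" for s
    by (simp add: overhang_def split: nat.split)
  have le: "F1 s \<le> F r" for s
    using F(3)[of s] F(3)[of "Suc s"] ov[of s] unfolding F1 by auto
  have b1: "b1 s = b s + a1 s - a s + overhang b a1 (Suc s) - overhang b a1 s" for s
    by (cases s) (auto simp: b1_def toggle_row_def overhang_def)
  \<comment> \<open>The sign of this difference decides whether a cell added in row \<open>s\<close>
    of \<open>b1\<close> raises the min or the max in the second toggle. In both cases below it
    raises the one that compensates the cell added to \<open>b\<close>, so \<open>d1\<close> does
    not change.\<close>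
  have dd: "d (Suc s) - b1 s = F (Suc s) - F s + b (Suc s) - a1 s - overhang b a1 (Suc s) + overhang b a1 s" for s
    unfolding b1 F_def excess_def by simp
  show ?thesis
  \<comment> \<open>The number \<open>b r\<close> enters the first toggle twice: in a min with
    \<open>a1 (r - 1)\<close> for part \<open>r\<close> and in a max with it for part
    \<open>r - 1\<close>. Increasing \<open>b r\<close> raises the max if
    \<open>a1 (r - 1) \<le> b r\<close>, which puts the new cell one row higher, and the min
    otherwise.\<close>
  proof (cases "\<exists>r0. r = Suc r0 \<and> a1 r0 \<le> b r")
    case True
    then obtain r0 where r0: "r = Suc r0" "a1 r0 \<le> b r" by blast
    have top: "F1 r0 = F r"
      using F(2)[of r0] ov[of r0] r0 unfolding F1 by auto
    have "F1 s < F r" if "s < r0" for s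
      using that F(2)[of s] F(2)[of "Suc s"] ov[of s] r0 unfolding F1 by auto
    then have "raises_at a1 b1 d1 r0"
      using top F(1) le unfolding raises_at_def F1_def[symmetric] by auto
    moreover have eq: "b1' = b1(r0 := b1 r0 + 1)"
      using r0 by (auto simp: b1'_def b1_def b'_def toggle_row_def fun_eq_iff split: nat.split)
    moreover have "b1 r0 < d r"
      using dd[of r0] r0 F(2)[of r0] ov[of r0] by (auto simp: overhang_def)
    then have "toggle_row b1' b' d = d1"
      using r0 unfolding eq by (auto simp: d1_def b'_def toggle_row_def fun_eq_iff split: nat.split)
    ultimately show ?thesis by blast
  next
    case False
    then have zero: "overhang b a1 r = 0"
      by (auto simp: overhang_def split: nat.split)
    have "F1 r = F r"
      using F(3)[of "Suc r"] zero unfolding F1 by auto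
    moreover have "F1 s < F r" if "s < r" for s
    proof (cases "Suc s = r")
      case True
      then have "b (Suc s) < a1 s"
        using False by auto
      then show ?thesis
        using that True F(2)[of s] ov[of s] unfolding F1 by auto
    next
      case False
      then show ?thesis
        using that F(2)[of s] F(2)[of "Suc s"] ov[of s] unfolding F1 by auto
    qed
    ultimately have "raises_at a1 b1 d1 r"
      using F(1) le unfolding raises_at_def F1_def[symmetric] by auto
    moreover have eq: "b1' = b1(r := b1 r + 1)"
      using False by (auto simp: b1'_def b1_def b'_def toggle_row_def fun_eq_iff split: nat.split)
    moreover have "d (Suc r) \<le> b1 r"
      using dd[of r] zero F(3)[of "Suc r"] by (auto simp: overhang_def)
    then have "toggle_row b1' b' d = d1"
      unfolding eq by (auto simp: d1_def b'_def toggle_row_def fun_eq_iff split: nat.split)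
    ultimately show ?thesis by blast
  qed
qed

text \<open>Every old value \<open>F s\<close> is at most a new value, in row \<open>s\<close> or,
  if the overhang there is positive, in row \<open>s - 1\<close>. So the new maximum bounds the old
  excess, which on an arbitrary array could be unbounded, and a first maximum exists.\<close>

lemma raises_at_toggle_row_conv:
  fixes a a1 b d :: "nat \<Rightarrow> int"
  defines "b1 \<equiv> toggle_row a1 a b"
  assumes r: "raises_at a1 b1 (toggle_row b1 b d) r"
  shows "\<exists>r'. raises_at a b d r'"
proof -
  define F where "F = excess a b d"
  define F1 where "F1 = excess a1 b1 (toggle_row b1 b d)"
  have F1: "F1 s = max (F (Suc s) - max (a1 s - b (Suc s)) 0) (F s - overhang b a1 s)" for s
    unfolding F1_def b1_def F_def by (rule excess_toggle_row)
  have top: "0 < F1 r" "\<And>s. F1 s \<le> F1 r"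
    using r unfolding raises_at_def F1_def by auto
  have "F s \<le> F1 r" for s
  proof (cases "overhang b a1 s = 0")
    case True
    then show ?thesis using F1[of s] top(2)[of s] by auto
  next
    case False
    then obtain s0 where "s = Suc s0" "a1 s0 < b s"
      by (auto simp: overhang_def split: nat.splits)
    then show ?thesis using F1[of s0] top(2)[of s0] by auto
  qed
  moreover have "0 \<le> overhang b a1 r"
    by (simp add: overhang_def split: nat.split)
  then have "0 < F r \<or> 0 < F (Suc r)"
    using F1[of r] top(1) by linarith
  ultimately show ?thesis
    unfolding F_def using raises_at_exists by blast
qed

section \<open>Evacuation\<close>

fun ladder :: "nat \<Rightarrow> nat \<Rightarrow> pattern \<Rightarrow> pattern" where
  "ladder a 0 G = G"
| "ladder a (Suc s) G = toggle (a + s) (ladder a s G)"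

text \<open>Switches the letters \<open>1, \<dots>, p\<close> with the next \<open>s\<close> letters: each ladder moves one letter past
  the \<open>s\<close> letters that follow it.\<close>

fun switch :: "nat \<Rightarrow> nat \<Rightarrow> pattern \<Rightarrow> pattern" where
  "switch 0 s G = G"
| "switch (Suc p) s G = switch p s (ladder (Suc p) s G)"

definition promote :: "nat \<Rightarrow> pattern \<Rightarrow> pattern" where
  "promote m = ladder 1 m"

text \<open>The Schuetzenberger involution, with \<open>promote\<close> in the role of promotion.
  The index counts toggles: \<open>evac m\<close> acts on the letters 1 to \<open>m + 1\<close> and
  changes only the rows 1 to \<open>m\<close>.\<close>

fun evac :: "nat \<Rightarrow> pattern \<Rightarrow> pattern" where
  "evac 0 G = G"
| "evac (Suc m) G = evac m (promote (Suc m) G)"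

definition evac_interval :: "nat \<Rightarrow> nat \<Rightarrow> pattern \<Rightarrow> pattern" where
  "evac_interval i j G = evac (j - 1) (evac (j - i) (evac (j - 1) G))"

lemma promote_Suc: "promote (Suc m) G = toggle (Suc m) (promote m G)"
  by (simp add: promote_def)

lemma promote_0: "promote 0 G = G"
  by (simp add: promote_def)

lemma toggle_promote: "Suc m < i \<Longrightarrow> toggle i (promote m G) = promote m (toggle i G)"
  by (induction m) (auto simp: promote_Suc promote_0 toggle_commute[of i])

lemma toggle_evac: "Suc m < i \<Longrightarrow> toggle i (evac m G) = evac m (toggle i G)"
  by (induction m arbitrary: G) (auto simp: toggle_promote)

text \<open>In the induction step the lower promotion is absorbed by the evacuation; the remaining
  toggle \<open>m + 2\<close> passes \<open>evac m\<close> and cancels the last toggle of the inner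
  promotion. Together with the recursion for \<open>evac\<close> this makes evacuation an
  involution.\<close>

lemma promote_evac: "promote (Suc m) (evac (Suc m) G) = evac m G"
proof (induction m arbitrary: G)
  case 0
  then show ?case by (simp add: promote_Suc promote_0)
next
  case (Suc m)
  have "promote (Suc (Suc m)) (evac (Suc (Suc m)) G) =
      toggle (Suc (Suc m)) (evac m (promote (Suc (Suc m)) G))"
    by (simp add: promote_Suc[of "Suc m"] Suc.IH del: evac.simps(2) add: evac.simps(2)[of "Suc m"])
  also have "\<dots> = evac m (promote (Suc m) G)"
    by (simp add: toggle_evac promote_Suc[of "Suc m"])
  finally show ?case by simp
qed

lemma evac_evac [simp]: "evac m (evac m G) = G"
proof (induction m arbitrary: G)
  case (Suc m)
  have "evac (Suc m) (evac (Suc m) G) = evac m (evac m G)"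
    by (simp only: evac.simps(2)[of m "evac (Suc m) G"] promote_evac)
  then show ?case using Suc by simp
qed simp

lemma promote_conv_evac: "promote (Suc m) G = evac m (evac (Suc m) G)"
  by simp

lemma evac_interval_evac_interval [simp]: "evac_interval i j (evac_interval i j G) = G"
  by (simp add: evac_interval_def)

lemma toggle_evac_interval:
  "1 \<le> k \<Longrightarrow> l < i \<Longrightarrow> toggle i (evac_interval k l G) = evac_interval k l (toggle i G)"
  by (cases "l = 0") (auto simp: evac_interval_def toggle_evac)

text \<open>For \<open>N = l\<close>, the promotion is \<open>evac (l - 1)\<close> after
  \<open>evac l\<close>, and squares of evacuations cancel in the triple products. Every further
  toggle has index above \<open>l\<close> and commutes with the interval ending at
  \<open>l\<close>.\<close>

lemma promote_evac_interval_shift: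
  assumes "1 \<le> k" "k < l" "l \<le> N"
  shows "promote N (evac_interval (Suc k) (Suc l) G) = evac_interval k l (promote N G)"
  using assms(3)
proof (induction N rule: dec_induct)
  case base
  then obtain l' where l: "l = Suc l'"
    using assms by (cases l) auto
  show ?case
    by (simp add: l evac_interval_def promote_conv_evac del: evac.simps)
next
  case (step N)
  then show ?case
    using assms by (simp add: promote_Suc toggle_evac_interval)
qed

text \<open>Each promotion inside \<open>evac N\<close> lowers the interval by one until it starts
  at 1. There \<open>evac_interval 1 l\<close> is just \<open>evac (l - 1)\<close>, whose conjugate
  by \<open>evac N\<close> is by definition an interval ending at \<open>N + 1\<close>.\<close>

lemma evac_conj_evac_interval:
  assumes "1 \<le> k" "k < l" "l \<le> Suc N"
  shows "evac N (evac_interval k l (evac N G)) = evac_interval (Suc (Suc N) - l) (Suc (Suc N) - k) G"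
  using assms
proof (induction N arbitrary: k l G)
  case 0
  then show ?case by auto
next
  case (Suc N)
  show ?case
  proof (cases "k = 1")
    case True
    then show ?thesis
      using Suc.prems by (simp add: evac_interval_def del: evac.simps)
  next
    case False
    obtain k' l' where kl: "k = Suc k'" "l = Suc l'"
      using Suc.prems by (cases k; cases l) auto
    have "evac (Suc N) (evac_interval k l (evac (Suc N) G)) =
        evac N (evac_interval k' l' (promote (Suc N) (evac (Suc N) G)))"
      using Suc.prems False kl by (simp add: promote_evac_interval_shift del: evac.simps add: evac.simps(2)[of N "evac_interval _ _ _"])
    also have "\<dots> = evac N (evac_interval k' l' (evac N G))"
      by (simp only: promote_evac)
    also have "\<dots> = evac_interval (Suc (Suc N) - l') (Suc (Suc N) - k') G"
      using Suc.prems False kl by (intro Suc.IH) auto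
    finally show ?thesis by (simp add: kl)
  qed
qed

text \<open>The inner interval is reflected three times, within the letters up to \<open>j\<close>,
  up to \<open>j - i + 1\<close>, and up to \<open>j\<close> again. The composite sends
  \<open>k\<close> to \<open>i + j - k\<close>.\<close>

lemma evac_interval_conj:
  assumes "1 \<le> i" "i \<le> k" "k < l" "l \<le> j"
  shows "evac_interval i j (evac_interval k l (evac_interval i j G)) = evac_interval (i + j - l) (i + j - k) G"
proof -
  define e where "e = evac (j - 1)"
  have e: "e (e x) = x" for x by (simp add: e_def)
  have "evac_interval i j (evac_interval k l (evac_interval i j G)) =
     e (evac (j - i) (e (evac_interval k l (e (evac (j - i) (e G))))))"
    by (simp add: evac_interval_def[of i j] e_def)
  also have "\<dots> = e (evac (j - i) (evac_interval (Suc j - l) (Suc j - k) (evac (j - i) (e G))))"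
    using evac_conj_evac_interval[of k l "j - 1" "evac (j - i) (e G)"] assms by (simp add: e_def)
  also have "\<dots> = e (evac_interval (Suc k - i) (Suc l - i) (e G))"
    using evac_conj_evac_interval[of "Suc j - l" "Suc j - k" "j - i" "e G"] assms
    by (simp add: Suc_diff_le)
  also have "\<dots> = evac_interval (i + j - l) (i + j - k) G"
  proof -
    have "Suc (Suc (j - 1)) - (Suc l - i) = i + j - l" "Suc (Suc (j - 1)) - (Suc k - i) = i + j - k"
      using assms by auto
    then show ?thesis
      using evac_conj_evac_interval[of "Suc k - i" "Suc l - i" "j - 1" "G"] assms
      unfolding e_def by simp
  qed
  finally show ?thesis .
qed

section \<open>Ladders and tableau switching\<close>

lemma toggle_ladder: "Suc i < a \<or> a + s < i \<Longrightarrow> toggle i (ladder a s G) = ladder a s (toggle i G)"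
  by (induction s) (auto simp: toggle_commute[of i])

lemma promote_ladder: "Suc m < a \<Longrightarrow> promote m (ladder a s G) = ladder a s (promote m G)"
  by (induction m) (auto simp: promote_0 promote_Suc toggle_ladder)

lemma evac_ladder: "Suc m < a \<Longrightarrow> evac m (ladder a s G) = ladder a s (evac m G)"
  by (induction m arbitrary: G) (auto simp: promote_ladder)

lemma promote_add: "promote (m + s) G = ladder (Suc m) s (promote m G)"
  by (induction s) (auto simp: promote_Suc)

lemma switch_eq_iff [simp]: "switch p s G = switch p s H \<longleftrightarrow> G = H"
proof -
  have "ladder (Suc p) s G = ladder (Suc p) s H \<longleftrightarrow> G = H" for p G H
    by (induction s) auto
  then show ?thesis by (induction p arbitrary: G H) auto
qed

lemma surj_switch: "\<exists>G. switch p s G = H"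
proof -
  have *: "\<exists>G. ladder (Suc p) s G = H" for p H
    by (induction s arbitrary: H) (auto, metis toggle_toggle zero_less_Suc)
  show ?thesis
    by (induction p arbitrary: H) (auto, metis *)
qed

text \<open>The blocks have \<open>p + 1\<close> and \<open>s + 1\<close> letters. A promotion
  across both is a promotion inside the first block followed by a ladder across the second; the
  ladders commute with the evacuations of the lower letters and collect into
  \<open>switch\<close>.\<close>

lemma evac_decompose:
  "evac (Suc (p + s)) G = evac s (switch (Suc p) (Suc s) (evac p G))"
proof (induction p arbitrary: G)
  case 0
  show ?case by (simp add: promote_def)
next
  case (Suc p)
  have "evac (Suc (Suc p + s)) G = evac (Suc (p + s)) (promote (Suc p + Suc s) G)"
    by simp
  also have "\<dots> = evac s (switch (Suc p) (Suc s) (evac p (ladder (Suc (Suc p)) (Suc s) (promote (Suc p) G))))"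
    by (simp only: Suc.IH promote_add)
  also have "\<dots> = evac s (switch (Suc (Suc p)) (Suc s) (evac (Suc p) G))"
    by (simp only: evac_ladder lessI switch.simps evac.simps)
  finally show ?case .
qed

section \<open>Raising operators\<close>

text \<open>The crystal raising operator: turning an entry \<open>i + 1\<close> into
  \<open>i\<close> adds a cell to \<open>G i\<close> and to no other row of the pattern. It is a
  relation because the operator is partial.\<close>

definition raise :: "nat \<Rightarrow> pattern \<Rightarrow> pattern \<Rightarrow> bool" where
  "raise i G H \<longleftrightarrow> (\<exists>r. raises_at (G (i - 1)) (G i) (G (Suc i)) r \<and>
     H = G(i := (G i)(r := G i r + 1)))"

lemma raise_unique: "raise i G H \<Longrightarrow> raise i G H' \<Longrightarrow> H = H'"
  unfolding raise_def using raises_at_unique by blast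

lemma raise_other: "raise i G H \<Longrightarrow> j \<noteq> i \<Longrightarrow> H j = G j"
  unfolding raise_def by auto

lemma sum_add_one:
  fixes b :: "nat \<Rightarrow> int"
  shows "sum (b(r := b r + 1)) {..<k} = sum b {..<k} + (if r < k then 1 else 0)"
  by (induction k) auto

text \<open>The added cell lowers the excess by 1 at \<open>r\<close> and by 2 beyond it, so the
  first maximum becomes the last one. This recovers \<open>r\<close> from the result and makes
  raising injective.\<close>

lemma raises_at_last_maximum:
  fixes a b d :: "nat \<Rightarrow> int"
  assumes "raises_at a b d r"
  defines "F \<equiv> excess a (b(r := b r + 1)) d"
  shows "s < r \<Longrightarrow> F s \<le> F r" and "r < s \<Longrightarrow> F s < F r"
proof -
  have F: "F s = excess a b d s - (if s < r then 0 else if s = r then 1 else 2)" for s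
    unfolding F_def excess_def sum_add_one by auto
  have le: "excess a b d s \<le> excess a b d r" and less: "s < r \<Longrightarrow> excess a b d s < excess a b d r"
    using assms(1) unfolding raises_at_def by auto
  show "s < r \<Longrightarrow> F s \<le> F r" and "r < s \<Longrightarrow> F s < F r"
    using le less unfolding F by auto
qed

lemma raise_injective:
  assumes "raise i X H" "raise i X' H'"
    and "H (i - 1) = H' (i - 1)" "H i = H' i" "H (Suc i) = H' (Suc i)" "0 < i"
  shows "X i = X' i"
proof -
  obtain r where r: "raises_at (X (i - 1)) (X i) (X (Suc i)) r" "H i = (X i)(r := X i r + 1)"
    using assms(1) unfolding raise_def by auto
  obtain r' where r': "raises_at (X' (i - 1)) (X' i) (X' (Suc i)) r'" "H' i = (X' i)(r' := X' i r' + 1)"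
    using assms(2) unfolding raise_def by auto
  have nb: "X (i - 1) = H (i - 1)" "X (Suc i) = H (Suc i)" "X' (i - 1) = H (i - 1)" "X' (Suc i) = H (Suc i)"
    using assms raise_other[OF assms(1), of "i - 1"] raise_other[OF assms(1), of "Suc i"]
      raise_other[OF assms(2), of "i - 1"] raise_other[OF assms(2), of "Suc i"] by auto
  define F where "F = excess (H (i - 1)) (H i) (H (Suc i))"
  have "s < r \<Longrightarrow> F s \<le> F r" "r < s \<Longrightarrow> F s < F r" for s
    using raises_at_last_maximum[OF r(1), of s] r(2) nb unfolding F_def by auto
  moreover have "s < r' \<Longrightarrow> F s \<le> F r'" "r' < s \<Longrightarrow> F s < F r'" for s
    using raises_at_last_maximum[OF r'(1), of s] r'(2) nb assms(4) unfolding F_def by auto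
  ultimately have "r = r'"
    by (metis linorder_neq_iff not_le)
  have "X i = (H i)(r := H i r - 1)" "X' i = (H' i)(r' := H' i r' - 1)"
    using r(2) r'(2) by auto
  then show ?thesis
    using \<open>r = r'\<close> assms(4) by simp
qed

lemma raise_toggle_far_aux:
  "Suc i < j \<or> Suc j < i \<Longrightarrow> raise i G H \<Longrightarrow> raise i (toggle j G) (toggle j H)"
  unfolding raise_def toggle_def by (fastforce simp: fun_eq_iff)

lemma raise_toggle_far:
  "Suc i < j \<or> Suc j < i \<Longrightarrow> 0 < j \<Longrightarrow> raise i (toggle j G) (toggle j H) \<longleftrightarrow> raise i G H"
  by (metis raise_toggle_far_aux toggle_toggle)

lemma raise_toggle_aux:
  assumes "0 < i" "raise (Suc i) G H"
  shows "raise i (toggle (Suc i) (toggle i G)) (toggle (Suc i) (toggle i H))"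
proof -
  define a1 a b d where "a1 = G (i - 1)" and "a = G i" and "b = G (Suc i)" and "d = G (Suc (Suc i))"
  obtain r where r: "raises_at a b d r" and H: "H = G(Suc i := b(r := b r + 1))"
    using assms(2) unfolding raise_def a_def b_def d_def by auto
  from raises_at_toggle_row[OF r, of a1] obtain r' where r':
    "raises_at a1 (toggle_row a1 a b) (toggle_row (toggle_row a1 a b) b d) r'"
    "toggle_row a1 a (b(r := b r + 1)) = (toggle_row a1 a b)(r' := toggle_row a1 a b r' + 1)"
    "toggle_row (toggle_row a1 a (b(r := b r + 1))) (b(r := b r + 1)) d = toggle_row (toggle_row a1 a b) b d"
    by blast
  have "i - 1 \<noteq> i" "i - 1 \<noteq> Suc i" using assms(1) by auto
  then have "toggle (Suc i) (toggle i H) = (toggle (Suc i) (toggle i G))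
      (i := (toggle_row a1 a b)(r' := toggle_row a1 a b r' + 1))"
    using r'(2,3) assms(1) by (simp add: toggle_def H a1_def a_def b_def d_def fun_upd_twist fun_eq_iff)
  then show ?thesis
    using r'(1) assms(1) \<open>i - 1 \<noteq> i\<close> \<open>i - 1 \<noteq> Suc i\<close> unfolding raise_def
    by (intro exI[of _ r']) (simp add: toggle_def a1_def a_def b_def d_def)
qed

text \<open>The two toggles shift the letters \<open>i + 1\<close>, \<open>i + 2\<close> down by
  one. For the converse, some raising of \<open>G\<close> exists, and it leads to \<open>H\<close>
  because raising is single-valued and toggles are injective.\<close>

lemma raise_toggle:
  assumes "0 < i"
  shows "raise i (toggle (Suc i) (toggle i G)) (toggle (Suc i) (toggle i H)) \<longleftrightarrow> raise (Suc i) G H"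
proof
  assume R: "raise i (toggle (Suc i) (toggle i G)) (toggle (Suc i) (toggle i H))"
  have "i - 1 \<noteq> i" "i - 1 \<noteq> Suc i" using assms(1) by auto
  then obtain r where "raises_at (G (i - 1)) (toggle_row (G (i - 1)) (G i) (G (Suc i)))
     (toggle_row (toggle_row (G (i - 1)) (G i) (G (Suc i))) (G (Suc i)) (G (Suc (Suc i)))) r"
    using R unfolding raise_def by (auto simp: toggle_def)
  from raises_at_toggle_row_conv[OF this] obtain H' where H': "raise (Suc i) G H'"
    unfolding raise_def by auto
  then show "raise (Suc i) G H"
    using raise_unique[OF R raise_toggle_aux[OF assms H']] assms by simp
qed (rule raise_toggle_aux[OF assms])

lemma raise_ladder_far:
  "Suc i < a \<or> a + s < i \<Longrightarrow> 0 < a \<Longrightarrow> raise i (ladder a s G) (ladder a s H) \<longleftrightarrow> raise i G H"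
  by (induction s) (auto simp: raise_toggle_far)

text \<open>Only the toggles \<open>i\<close> and \<open>i + 1\<close> of the ladder interact with
  the operator: the earlier ones commute with raising at \<open>i + 1\<close>, the later ones with
  raising at \<open>i\<close>.\<close>

lemma raise_ladder:
  assumes "0 < a" "a \<le> i" "Suc i < a + s"
  shows "raise i (ladder a s G) (ladder a s H) \<longleftrightarrow> raise (Suc i) G H"
  using assms(3)
proof (induction s)
  case (Suc s)
  show ?case
  proof (cases "Suc i = a + s")
    case True
    then obtain t where t: "s = Suc t" "i = a + t"
      using assms by (cases s) auto
    have "raise i (ladder a (Suc s) G) (ladder a (Suc s) H) \<longleftrightarrow>
      raise i (toggle (Suc i) (toggle i (ladder a t G))) (toggle (Suc i) (toggle i (ladder a t H)))"
      by (simp add: t)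
    also have "\<dots> \<longleftrightarrow> raise (Suc i) G H"
      using assms t by (simp add: raise_toggle raise_ladder_far)
    finally show ?thesis .
  next
    case False
    then show ?thesis
      using Suc assms by (simp add: raise_toggle_far)
  qed
qed (use assms in simp)

lemma raise_switch:
  assumes "0 < i" "i < s"
  shows "raise i (switch p s G) (switch p s H) \<longleftrightarrow> raise (i + p) G H"
  using assms by (induction p arbitrary: G H) (auto simp: raise_ladder)

text \<open>Gelfand-Tsetlin patterns with infinitely many rows. Nonnegative and weakly decreasing
  rows follow from the zeros and the interlacing. The rows need not stabilise, so a pattern need not
  come from a tableau.\<close>

definition gt_patterns :: "pattern set" where
  "gt_patterns = {G. (\<forall>i r. i \<le> r \<longrightarrow> G i r = 0) \<and>
     (\<forall>i r. G i r \<le> G (Suc i) r \<and> G (Suc i) (Suc r) \<le> G i r)}"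

lemma gt_patternsD:
  assumes "G \<in> gt_patterns"
  shows "i \<le> r \<Longrightarrow> G i r = 0" "G i r \<le> G (Suc i) r" "G (Suc i) (Suc r) \<le> G i r"
  using assms by (auto simp: gt_patterns_def)

lemma gt_patterns_mono:
  assumes "G \<in> gt_patterns" "i \<le> j"
  shows "G i r \<le> G j r"
  using assms(2) by (induction rule: dec_induct) (use gt_patternsD[OF assms(1)] in \<open>auto intro: order.trans\<close>)

lemma gt_patterns_nonneg:
  assumes "G \<in> gt_patterns"
  shows "0 \<le> G i r"
proof (cases "i \<le> r")
  case False
  then show ?thesis
    using gt_patterns_mono[OF assms, of r i r] gt_patternsD(1)[OF assms, of r r] by simp
qed (simp add: gt_patternsD[OF assms])

lemma toggle_gt_patterns:
  assumes "G \<in> gt_patterns" "0 < i"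
  shows "toggle i G \<in> gt_patterns"
proof -
  note g = gt_patternsD[OF assms(1)]
  obtain k where i: "i = Suc k" using assms(2) by (cases i) auto
  define x where "x = toggle_row (G k) (G i) (G (Suc i))"
  have T: "toggle i G = G(i := x)" by (simp add: toggle_def x_def i)
  have "x r = 0" if "i \<le> r" for r
    using that g(1)[of k "r - 1"] g(1)[of k r] g(1)[of i r] g(1)[of "Suc i" "Suc r"] gt_patterns_nonneg[OF assms(1), of "Suc i" r]
    by (cases r) (auto simp: x_def toggle_row_def i)
  moreover have "G k r \<le> x r" "x r \<le> G (Suc i) r" "G (Suc i) (Suc r) \<le> x r" "x (Suc r) \<le> G k r" for r
    using g(2)[of k r] g(2)[of i r] g(3)[of i r] g(3)[of k "r - 1"] g(2)[of k "Suc r"] g(2)[of i "Suc r"] g(3)[of i "r - 1"]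
      g(3)[of i "Suc r"] g(3)[of k r]
    by (auto simp: x_def toggle_row_def i split: nat.split)
  ultimately show ?thesis
    using g unfolding T gt_patterns_def by (auto simp: i)
qed

text \<open>The excess is positive and jumps upwards at its first maximum \<open>r\<close>. By
  interlacing this leaves room for the new cell inside \<open>G (i + 1) r\<close> and, for positive
  \<open>r\<close>, below \<open>G (i - 1) (r - 1)\<close>.\<close>

lemma raise_gt_patterns:
  assumes "G \<in> gt_patterns" "0 < i" "raise i G H"
  shows "H \<in> gt_patterns"
proof -
  note g = gt_patternsD[OF assms(1)]
  obtain k where i: "i = Suc k" using assms(2) by (cases i) auto
  obtain r where r: "raises_at (G k) (G i) (G (Suc i)) r" and H: "H = G(i := (G i)(r := G i r + 1))"
    using assms(3) unfolding raise_def by (auto simp: i)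
  define F where "F = excess (G k) (G i) (G (Suc i))"
  have F: "0 < F r" "\<And>s. s < r \<Longrightarrow> F s < F r"
    using r unfolding raises_at_def F_def by auto
  have step: "F (Suc s) = F s + G (Suc i) (Suc s) - G i (Suc s) - G i s + G k s" for s
    by (simp add: F_def excess_def)
  have "F 0 = G (Suc i) 0 - G i 0"
    by (simp add: F_def excess_def)
  then have 1: "G i r + 1 \<le> G (Suc i) r"
    using F(1) F(2)[of "r - 1"] step[of "r - 1"] g(2)[of k "r - 1"] by (cases r) (auto simp: i)
  have 2: "G i r + 1 \<le> G k s" if "r = Suc s" for s
    using F(2)[of s] step[of s] that g(3)[of i s] by auto
  have "r < i"
  proof (rule ccontr)
    assume "\<not> r < i"
    then obtain s where "r = Suc s" "k \<le> s" by (cases r) (auto simp: i)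
    then show False
      using 2[of s] g(1)[of i r] g(1)[of k s] by (simp add: i)
  qed
  moreover have "G k r \<le> G i r + 1" "G (Suc i) (Suc r) \<le> G i r + 1"
    using g(2)[of k r] g(3)[of i r] by (auto simp: i)
  ultimately show ?thesis
    using g 1 2 unfolding H gt_patterns_def by (auto simp: i)
qed

lemma excess_eventually_const:
  assumes "G \<in> gt_patterns" "0 < i" "i \<le> r"
  shows "excess (G (i - 1)) (G i) (G (Suc i)) r = excess (G (i - 1)) (G i) (G (Suc i)) i"
  using assms(3)
proof (induction r rule: dec_induct)
  case (step r)
  then show ?case
    using gt_patternsD(1)[OF assms(1)] by (auto simp: excess_def)
qed simp

lemma raise_exists:
  assumes "G \<in> gt_patterns" "0 < i" "0 < excess (G (i - 1)) (G i) (G (Suc i)) r"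
  shows "\<exists>H. raise i G H"
proof -
  let ?F = "excess (G (i - 1)) (G i) (G (Suc i))"
  have "?F s \<le> Max (?F ` {..i})" for s
  proof (cases "s \<le> i")
    case False
    then show ?thesis
      using excess_eventually_const[OF assms(1,2), of s] by simp
  qed simp
  then show ?thesis
    using raises_at_exists assms(3) unfolding raise_def by blast
qed

section \<open>Dual equivalence\<close>

fun raises :: "nat list \<Rightarrow> pattern \<Rightarrow> pattern \<Rightarrow> bool" where
  "raises [] G H \<longleftrightarrow> G = H"
| "raises (i # w) G H \<longleftrightarrow> (\<exists>G'. raise i G G' \<and> raises w G' H)"

definition highest :: "nat \<Rightarrow> pattern \<Rightarrow> bool" where
  "highest s G \<longleftrightarrow> (\<forall>i H. 0 < i \<and> i < s \<longrightarrow> \<not> raise i G H)"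

lemma raises_gt_patterns:
  "raises w G H \<Longrightarrow> set w \<subseteq> {0<..} \<Longrightarrow> G \<in> gt_patterns \<Longrightarrow> H \<in> gt_patterns"
proof (induction w arbitrary: G)
  case (Cons i w)
  then obtain G' where "raise i G G'" "raises w G' H" by auto
  then show ?case
    using Cons raise_gt_patterns[of G i G'] by auto
qed simp

lemma raises_other: "raises w G H \<Longrightarrow> j \<notin> set w \<Longrightarrow> H j = G j"
  by (induction w arbitrary: G) (auto simp: raise_other)

text \<open>A raising at \<open>i < s\<close> is undone from the rows \<open>i - 1\<close>,
  \<open>i\<close>, \<open>i + 1\<close>, all within the first \<open>s\<close>. The ends of the two
  paths are compared only there, because \<open>K H\<close> and \<open>H\<close> are shown to agree
  only there.\<close>

lemma raises_injective:
  assumes "raises w X H" "raises w X' H'" "set w \<subseteq> {0<..<s}"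
    and "\<And>j. j \<le> s \<Longrightarrow> H j = H' j"
  shows "j \<le> s \<Longrightarrow> X j = X' j"
  using assms(1-3)
proof (induction w arbitrary: X X' j)
  case Nil
  then show ?case using assms(4) by simp
next
  case (Cons i w)
  obtain Y Y' where Y: "raise i X Y" "raises w Y H" "raise i X' Y'" "raises w Y' H'"
    using Cons.prems by auto
  then have eq: "Y k = Y' k" if "k \<le> s" for k
    using Cons.IH that Cons.prems by auto
  then have "X i = X' i"
    using raise_injective[OF Y(1,3)] Cons.prems by auto
  then show ?case
    using raise_other[OF Y(1)] raise_other[OF Y(3)] eq Cons.prems(1) by (cases "j = i") metis+
qed

lemma highest_exists:
  assumes "G \<in> gt_patterns"
  shows "\<exists>w H. set w \<subseteq> {0<..<s} \<and> raises w G H \<and> highest s H"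
  using assms
\<comment> \<open>The measure counts the cells of \<open>G s\<close> missing from the smaller shapes
  \<open>G i\<close>. A raising at \<open>i < s\<close> fills one of them and keeps
  \<open>G s\<close>.\<close>
proof (induction "\<Sum>i<s. \<Sum>r<s. nat (G s r - G i r)" arbitrary: G rule: less_induct)
  case less
  show ?case
  proof (cases "highest s G")
    case True
    then show ?thesis by (intro exI[of _ "[]"]) auto
  next
    case False
    then obtain i H where i: "0 < i" "i < s" "raise i G H"
      by (auto simp: highest_def)
    have H: "H \<in> gt_patterns"
      using raise_gt_patterns[OF less.prems i(1,3)] .
    obtain r where r: "H = G(i := (G i)(r := G i r + 1))"
      using i(3) unfolding raise_def by blast
    have "r < i"
      using gt_patternsD(1)[OF H, of i r] gt_patterns_nonneg[OF less.prems, of i r] by (force simp: r)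
    have "(\<Sum>i<s. \<Sum>r<s. nat (H s r - H i r)) < (\<Sum>i<s. \<Sum>r<s. nat (G s r - G i r))"
    proof (rule sum_strict_mono_ex1)
      show "\<forall>k\<in>{..<s}. (\<Sum>r<s. nat (H s r - H k r)) \<le> (\<Sum>r<s. nat (G s r - G k r))"
        using i(2) by (auto simp: r intro!: sum_mono)
      have "(\<Sum>r<s. nat (H s r - H i r)) < (\<Sum>r<s. nat (G s r - G i r))"
      proof (rule sum_strict_mono_ex1)
        show "\<forall>k\<in>{..<s}. nat (H s k - H i k) \<le> nat (G s k - G i k)"
          using i(2) by (auto simp: r)
        have "H i r \<le> H s r"
          using gt_patterns_mono[OF H] i(2) by simp
        then show "\<exists>k\<in>{..<s}. nat (H s k - H i k) < nat (G s k - G i k)"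
          using i(2) \<open>r < i\<close> by (intro bexI[of _ r]) (auto simp: r)
      qed simp
      then show "\<exists>k\<in>{..<s}. (\<Sum>r<s. nat (H s r - H k r)) < (\<Sum>r<s. nat (G s r - G k r))"
        using i(2) by auto
    qed simp
    from less.hyps[OF this H] obtain w K where "set w \<subseteq> {0<..<s}" "raises w H K" "highest s K"
      by blast
    then show ?thesis
      using i by (intro exI[of _ "i # w"] exI[of _ K]) auto
  qed
qed

text \<open>On the first \<open>s\<close> letters, each row of a highest weight tableau contains a
  single letter. Given the induction hypothesis, nonpositive excess bounds the partial sums of the
  next shape by those of the present one; containment of shapes gives the opposite bound.\<close>

lemma highest_rows:
  assumes "G \<in> gt_patterns" "highest s G"
  shows "j < s \<Longrightarrow> r < j \<Longrightarrow> G (Suc j) r = G j r"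
proof (induction j arbitrary: r)
  case (Suc j)
  have nonpos: "excess (G j) (G (Suc j)) (G (Suc (Suc j))) r \<le> 0" for r
  proof (rule ccontr)
    assume "\<not> ?thesis"
    then obtain H where "raise (Suc j) G H"
      using raise_exists[OF assms(1), of "Suc j" r] by auto
    then show False
      using assms(2) Suc.prems unfolding highest_def by auto
  qed
  have "sum (G (Suc j)) {..<r} = sum (G j) {..<r}"
    using Suc.IH Suc.prems by (intro sum.cong) auto
  with nonpos[of r] have "sum (G (Suc (Suc j))) {..<Suc r} \<le> sum (G (Suc j)) {..<Suc r}"
    by (simp add: excess_def)
  moreover have "sum (G (Suc j)) {..<r} \<le> sum (G (Suc (Suc j))) {..<r}"
    by (intro sum_mono gt_patternsD[OF assms(1)])
  ultimately show ?case
    using gt_patternsD(2)[OF assms(1), of "Suc j" r] by simp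
qed simp

definition weight :: "pattern \<Rightarrow> nat \<Rightarrow> int" where
  "weight G j = sum (G j) {..<j} - sum (G (j - 1)) {..<j - 1}"

lemma highest_eq_weight:
  assumes "G \<in> gt_patterns" "highest s G" "j < s"
  shows "G (Suc j) j = weight G (Suc j)"
proof -
  have "sum (G (Suc j)) {..<j} = sum (G j) {..<j}"
    using highest_rows[OF assms(1,2)] assms(3) by (intro sum.cong) auto
  then show ?thesis by (simp add: weight_def)
qed

text \<open>Serves to compare \<open>K H\<close> with \<open>H\<close>, whose shapes are not known
  to be equal beforehand. The letter \<open>j + 1\<close> occurs only in row \<open>j\<close>, so
  its multiplicity is the one new part of the shape.\<close>

lemma highest_unique_weight:
  assumes "G \<in> gt_patterns" "highest s G" "H \<in> gt_patterns" "highest s H"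
    and "\<And>j. 0 < j \<Longrightarrow> j \<le> s \<Longrightarrow> weight G j = weight H j"
  shows "j \<le> s \<Longrightarrow> G j = H j"
proof (induction j)
  case 0
  show ?case using gt_patternsD(1)[OF assms(1)] gt_patternsD(1)[OF assms(3)] by auto
next
  case (Suc j)
  show ?case
  proof
    fix r
    consider "r < j" | "r = j" | "j < r" by linarith
    then show "G (Suc j) r = H (Suc j) r"
    proof cases
      case 1
      then show ?thesis
        using highest_rows[OF assms(1,2)] highest_rows[OF assms(3,4)] Suc by auto
    next
      case 2
      then show ?thesis
        using highest_eq_weight[OF assms(1,2)] highest_eq_weight[OF assms(3,4)] assms(5) Suc by auto
    next
      case 3
      then show ?thesis
        using gt_patternsD(1)[OF assms(1)] gt_patternsD(1)[OF assms(3)] by auto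
    qed
  qed
qed

lemma highest_unique_shape:
  assumes "G \<in> gt_patterns" "highest s G" "H \<in> gt_patterns" "highest s H" "G s = H s" "j \<le> s"
  shows "G j = H j"
  using assms(6)
proof (induction j rule: inc_induct)
  case (step j)
  show ?case
  proof
    fix r
    show "G j r = H j r"
    proof (cases "r < j")
      case True
      then show ?thesis
        using step highest_rows[OF assms(1,2), of j r] highest_rows[OF assms(3,4), of j r] by auto
    next
      case False
      then show ?thesis
        using gt_patternsD(1)[OF assms(1)] gt_patternsD(1)[OF assms(3)] by auto
    qed
  qed
qed (use assms in simp)

section \<open>Weights under toggles and switching\<close>

lemma sum_toggle_pattern:
  assumes "G \<in> gt_patterns" "0 < i"
  shows "sum (toggle i G i) {..<i} =
    sum (G (i - 1)) {..<i - 1} + sum (G (Suc i)) {..<Suc i} - sum (G i) {..<i}"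
proof -
  note g = gt_patternsD(1)[OF assms(1)]
  obtain k where i: "i = Suc k" using assms(2) by (cases i) auto
  have "sum (toggle i G i) {..<i} = sum (toggle i G i) {..<Suc i}"
    using gt_patternsD(1)[OF toggle_gt_patterns[OF assms], of i i] by simp
  also have "\<dots> = sum (G (Suc i)) {..<Suc i} + sum (G k) {..<Suc i} - sum (G i) {..<Suc i} +
      overhang (G (Suc i)) (G k) (Suc i)"
    by (simp only: toggle_def i fun_upd_same diff_Suc_1 sum_toggle_row)
  also have "overhang (G (Suc i)) (G k) (Suc i) = 0"
    by (simp add: overhang_def g i)
  also have "sum (G k) {..<Suc i} = sum (G k) {..<k}"
    by (simp add: g i)
  also have "sum (G i) {..<Suc i} = sum (G i) {..<i}"
    by (simp add: g)
  finally show ?thesis by (simp add: i)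
qed

lemma weight_toggle:
  assumes "G \<in> gt_patterns" "0 < i"
  shows "weight (toggle i G) j = weight G (if j = i then Suc i else if j = Suc i then i else j)"
proof (cases "j = i \<or> j = Suc i")
  case True
  then show ?thesis
    using sum_toggle_pattern[OF assms] assms(2) toggle_other[of "i - 1" i G]
    by (auto simp: weight_def toggle_other simp del: sum.lessThan_Suc)
next
  case False
  then have "j - 1 = i \<Longrightarrow> j = 0" by linarith
  then show ?thesis
    using False assms(2) by (cases "j = 0") (auto simp: weight_def toggle_other)
qed

lemma ladder_gt_patterns: "G \<in> gt_patterns \<Longrightarrow> 0 < a \<Longrightarrow> ladder a s G \<in> gt_patterns"
  by (induction s) (auto simp: toggle_gt_patterns)

lemma switch_gt_patterns: "G \<in> gt_patterns \<Longrightarrow> switch p s G \<in> gt_patterns"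
  by (induction p arbitrary: G) (auto simp: ladder_gt_patterns)

lemma switch_gt_patterns_iff: "switch p s G \<in> gt_patterns \<longleftrightarrow> G \<in> gt_patterns"
proof
  have lad: "G \<in> gt_patterns" if "ladder (Suc a) s G \<in> gt_patterns" for a G
    using that
  proof (induction s)
    case (Suc s)
    then show ?case
      using toggle_gt_patterns[OF Suc.prems, of "Suc a + s"] by simp
  qed simp
  show "G \<in> gt_patterns" if "switch p s G \<in> gt_patterns"
    using that by (induction p arbitrary: G) (auto dest: lad)
qed (rule switch_gt_patterns)

lemma weight_ladder:
  assumes "G \<in> gt_patterns" "0 < a" "0 < j"
  shows "weight (ladder a s G) j = weight G
    (if a \<le> j \<and> j < a + s then Suc j else if j = a + s then a else j)"
  using assms(3)
proof (induction s arbitrary: j)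
  case (Suc s)
  then show ?case
    using assms by (auto simp: weight_toggle ladder_gt_patterns)
qed auto

lemma weight_switch:
  assumes "G \<in> gt_patterns" "0 < j" "j \<le> s"
  shows "weight (switch p s G) j = weight G (j + p)"
  using assms(1)
  by (induction p arbitrary: G) (use assms in \<open>auto simp: weight_ladder ladder_gt_patterns\<close>)

lemma promote_gt_patterns: "G \<in> gt_patterns \<Longrightarrow> promote m G \<in> gt_patterns"
  by (simp add: promote_def ladder_gt_patterns)

lemma evac_gt_patterns: "G \<in> gt_patterns \<Longrightarrow> evac m G \<in> gt_patterns"
  by (induction m arbitrary: G) (auto simp: promote_gt_patterns)

lemma promote_other: "m < j \<Longrightarrow> promote m G j = G j"
  by (induction m) (auto simp: promote_0 promote_Suc toggle_other)

lemma evac_other: "m < j \<Longrightarrow> evac m G j = G j"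
  by (induction m arbitrary: G) (auto simp: promote_other)

lemma promote_cong:
  assumes "\<And>j. j \<le> s \<Longrightarrow> G j = H j" "m < s"
  shows "j \<le> s \<Longrightarrow> promote m G j = promote m H j"
  using assms(2)
proof (induction m arbitrary: j)
  case (Suc m)
  then have "promote m G k = promote m H k" if "k \<le> s" for k
    using that by simp
  then show ?case
    using Suc.prems by (simp add: promote_Suc toggle_def)
qed (simp add: promote_0 assms(1))

lemma evac_cong:
  assumes "\<And>j. j \<le> s \<Longrightarrow> G j = H j" "m < s"
  shows "j \<le> s \<Longrightarrow> evac m G j = evac m H j"
  using assms
proof (induction m arbitrary: G H)
  case (Suc m)
  have "promote (Suc m) G k = promote (Suc m) H k" if "k \<le> s" for k
    using promote_cong[OF Suc.prems(2,3) that] .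
  from Suc.IH[OF Suc.prems(1) this] show ?case
    using Suc.prems(3) by simp
qed simp

lemma raises_conj:
  assumes "\<And>i G H. i \<in> set w \<Longrightarrow> raise i (K G) (K H) \<longleftrightarrow> raise i G H"
  shows "raises w X H \<Longrightarrow> raises w (K X) (K H)"
  using assms
proof (induction w arbitrary: X)
  case (Cons i w)
  then show ?case
    by (metis list.set_intros raises.simps(2))
qed simp

text \<open>To be applied with \<open>K = W t_m W^-1\<close>. Of evacuation the argument uses that
  it preserves \<open>gt_patterns\<close>, that it keeps the rows from \<open>s\<close> on, and that
  its rows up to \<open>s\<close> depend on the rows up to \<open>s\<close> alone. Once
  \<open>K\<close> fixes those rows of \<open>X\<close> and of its evacuation, both sides agree
  there.\<close>

lemma evac_commute_conj:
  assumes K: "\<And>i G H. 0 < i \<Longrightarrow> i < s \<Longrightarrow> raise i (K G) (K H) \<longleftrightarrow> raise i G H"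
    and surj: "\<And>H. \<exists>G. K G = H"
    and K_gt: "\<And>G. G \<in> gt_patterns \<Longrightarrow> K G \<in> gt_patterns"
    and K_weight: "\<And>G j. G \<in> gt_patterns \<Longrightarrow> 0 < j \<Longrightarrow> j \<le> s \<Longrightarrow> weight (K G) j = weight G j"
    and X: "X \<in> gt_patterns" and s: "0 < s"
  shows "K (evac (s - 1) X) = evac (s - 1) (K X)"
proof -
  define X' where "X' = evac (s - 1) X"
  have X': "X' \<in> gt_patterns" "\<And>j. s \<le> j \<Longrightarrow> X' j = X j"
    using X s by (auto simp: X'_def evac_gt_patterns evac_other)
  obtain w H where w: "set w \<subseteq> {0<..<s}" "raises w X H" "highest s H"
    using highest_exists[OF X] by blast
  obtain w' H' where w': "set w' \<subseteq> {0<..<s}" "raises w' X' H'" "highest s H'"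
    using highest_exists[OF X'(1)] by blast
  have gt: "H \<in> gt_patterns" "H' \<in> gt_patterns"
    using w(1) w'(1) by (auto intro!: raises_gt_patterns[OF w(2) _ X] raises_gt_patterns[OF w'(2) _ X'(1)])
  have above: "H j = X j" "H' j = X j" if "s \<le> j" for j
  proof -
    have "j \<notin> set w" "j \<notin> set w'" using w(1) w'(1) that by auto
    then show "H j = X j" "H' j = X j"
      using raises_other[OF w(2), of j] raises_other[OF w'(2), of j] X'(2) that by auto
  qed
  have "H' j = H j" for j
    using highest_unique_shape[OF gt(2) w'(3) gt(1) w(3), of j] above by (cases "j \<le> s") auto
  then have H': "H' = H" by auto
  have Kw: "raises w (K X) (K H)" "raises w' (K X') (K H)"
  proof -
    have "0 < i \<and> i < s" if "i \<in> set w \<union> set w'" for i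
      using that w(1) w'(1) by auto
    then have conj: "raise i (K G) (K H) \<longleftrightarrow> raise i G H" if "i \<in> set w \<union> set w'" for i G H
      using that K by blast
    show "raises w (K X) (K H)"
      by (rule raises_conj[OF _ w(2)]) (simp add: conj)
    show "raises w' (K X') (K H)"
      by (rule raises_conj[OF _ w'(2)[unfolded H']]) (simp add: conj)
  qed
  have "highest s (K H)"
    unfolding highest_def
  proof (intro allI impI notI)
    fix i Y assume i: "0 < i \<and> i < s" and Y: "raise i (K H) Y"
    \<comment> \<open>Surjectivity of \<open>K\<close> makes the target of the raising an image, so
      that the raising pulls back to one of \<open>H\<close>.\<close>
    obtain Z where "K Z = Y" using surj by blast
    then have "raise i H Z" using K[of i H Z] i Y by simp
    then show False using w(3) i unfolding highest_def by blast
  qed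
  then have KH: "K H j = H j" if "j \<le> s" for j
    using highest_unique_weight[OF K_gt[OF gt(1)] _ gt(1) w(3)] K_weight[OF gt(1)] that by auto
  have KX: "K X j = X j" if "j \<le> s" for j
    using raises_injective[OF Kw(1) w(2) w(1) KH that] by simp
  have KX': "K X' j = X' j" if "j \<le> s" for j
    using raises_injective[OF Kw(2) w'(2)[unfolded H'] w'(1) KH that] by simp
  have "K X' j = evac (s - 1) (K X) j" for j
  proof (cases "j \<le> s")
    case True
    then show ?thesis
      using KX' evac_cong[of s "K X" X "s - 1" j] KX s by (simp add: X'_def)
  next
    case False
    \<comment> \<open>Beyond row \<open>s\<close> evacuation changes nothing, and \<open>K X\<close>
      and \<open>K X'\<close> both agree there with \<open>K H\<close>.\<close>
    then have "j \<notin> set w" "j \<notin> set w'" using w(1) w'(1) by auto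
    then show ?thesis
      using raises_other[OF Kw(1), of j] raises_other[OF Kw(2), of j] False s by (simp add: evac_other)
  qed
  then show ?thesis by (auto simp: X'_def)
qed

text \<open>With \<open>W = switch p (s + 1)\<close>, the last premise says that \<open>G'\<close>
  is \<open>W^-1 q_s W G\<close>; this relation survives \<open>t_m\<close>. Behind the switch lie
  raising at \<open>i + p\<close> and the weights of the letters beyond \<open>p\<close>, and
  \<open>t_m\<close> with \<open>m < p\<close> commutes with the former and keeps the
  latter.\<close>

lemma toggle_switch_evac:
  assumes "G \<in> gt_patterns" "0 < m" "m < p" "switch p (Suc s) G' = evac s (switch p (Suc s) G)"
  shows "switch p (Suc s) (toggle m G') = evac s (switch p (Suc s) (toggle m G))"
proof -
  define W where "W = switch p (Suc s)"
  define V where "V = inv_into UNIV W"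
  define K where "K X = W (toggle m (V X))" for X
  have inv: "V (W G) = G" "W (V G) = G" for G
  proof -
    have "bij W"
      unfolding W_def bij_def inj_def surj_def using surj_switch by (metis switch_eq_iff)
    then show "V (W G) = G" "W (V G) = G"
      by (simp_all add: V_def bij_is_inj bij_is_surj surj_f_inv_f)
  qed
  have gt: "V X \<in> gt_patterns" if "X \<in> gt_patterns" for X
    using that switch_gt_patterns_iff[of p "Suc s" "V X"] inv by (simp add: W_def)
  have "K (evac (Suc s - 1) (W G)) = evac (Suc s - 1) (K (W G))"
  proof (rule evac_commute_conj)
    fix i X Y assume i: "0 < i" "i < Suc s"
    have "raise i (K X) (K Y) \<longleftrightarrow> raise (i + p) (toggle m (V X)) (toggle m (V Y))"
      using i by (simp add: K_def W_def raise_switch)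
    also have "\<dots> \<longleftrightarrow> raise (i + p) (V X) (V Y)"
      using i assms by (simp add: raise_toggle_far)
    also have "\<dots> \<longleftrightarrow> raise i (W (V X)) (W (V Y))"
      using i by (simp add: W_def raise_switch)
    finally show "raise i (K X) (K Y) \<longleftrightarrow> raise i X Y"
      by (simp add: inv)
  next
    fix Y
    have "K (W (toggle m (V Y))) = Y"
      using assms(2) by (simp add: K_def inv)
    then show "\<exists>X. K X = Y" by blast
  next
    fix X :: pattern assume X: "X \<in> gt_patterns"
    then show "K X \<in> gt_patterns"
      using gt[OF X] assms(2) unfolding K_def W_def by (intro switch_gt_patterns toggle_gt_patterns)
    fix j assume j: "0 < j" "j \<le> Suc s"
    have "weight (K X) j = weight (toggle m (V X)) (j + p)"
      using j gt[OF X] assms(2) unfolding K_def W_def by (intro weight_switch toggle_gt_patterns)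
    also have "\<dots> = weight (V X) (j + p)"
      using gt[OF X] assms j by (simp add: weight_toggle)
    also have "\<dots> = weight (W (V X)) j"
      using j gt[OF X] by (simp add: W_def weight_switch)
    finally show "weight (K X) j = weight X j"
      by (simp add: inv)
  next
    show "W G \<in> gt_patterns"
      using assms(1) by (simp add: W_def switch_gt_patterns)
  qed simp
  moreover have "W G' = evac s (W G)"
    using assms(4) by (simp add: W_def)
  then have "V (evac s (W G)) = G'"
    using inv(1)[of G'] by simp
  ultimately have "W (toggle m G') = evac s (W (toggle m G))"
    by (simp add: K_def inv)
  then show ?thesis
    by (simp add: W_def)
qed

section \<open>From single toggles to disjoint intervals\<close>

lemma promote_rel:
  assumes "\<And>i x y. 0 < i \<Longrightarrow> i \<le> m \<Longrightarrow> R x y \<Longrightarrow> R (toggle i x) (toggle i y)"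
  shows "R x y \<Longrightarrow> R (promote m x) (promote m y)"
  using assms by (induction m) (auto simp: promote_0 promote_Suc)

text \<open>Commutation is phrased as a relation kept by every toggle, so that it can also carry
  membership in \<open>gt_patterns\<close> and express an inverse of \<open>switch\<close> without
  naming it.\<close>

lemma evac_rel:
  assumes "\<And>i x y. 0 < i \<Longrightarrow> i \<le> m \<Longrightarrow> R x y \<Longrightarrow> R (toggle i x) (toggle i y)"
  shows "R x y \<Longrightarrow> R (evac m x) (evac m y)"
  using assms
proof (induction m arbitrary: x y)
  case (Suc m)
  from Suc.prems(1) have "R (promote (Suc m) x) (promote (Suc m) y)"
    by (rule promote_rel[rotated]) (rule Suc.prems(2))
  then show ?case
    using Suc.IH[of "promote (Suc m) x" "promote (Suc m) y"] Suc.prems(2) by simp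
qed simp

lemma evac_interval_rel:
  assumes "\<And>a x y. 0 < a \<Longrightarrow> a < j \<Longrightarrow> R x y \<Longrightarrow> R (toggle a x) (toggle a y)"
    and "R x y" "1 \<le> i" "i < j"
  shows "R (evac_interval i j x) (evac_interval i j y)"
  unfolding evac_interval_def using assms
  by (intro evac_rel[of _ R]) auto

text \<open>The interval is the conjugate of \<open>evac s\<close> by
  \<open>evac (p + s + 1)\<close>. Decomposing the latter on both sides produces a common outer
  \<open>evac s\<close>, which cancels.\<close>

lemma evac_interval_conv_switch:
  "Q = evac_interval (Suc (Suc p)) (Suc (Suc (p + s))) G \<longleftrightarrow>
     switch (Suc p) (Suc s) (evac p Q) = evac s (switch (Suc p) (Suc s) (evac p G))"
proof -
  have inj: "evac m X = evac m Y \<longleftrightarrow> X = Y" for m X Y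
    by (metis evac_evac)
  have "Q = evac_interval (Suc (Suc p)) (Suc (Suc (p + s))) G \<longleftrightarrow>
      evac (Suc (p + s)) Q = evac s (evac (Suc (p + s)) G)"
    by (metis add_diff_cancel_left' diff_Suc_1 diff_Suc_Suc evac_evac evac_interval_def)
  also have "\<dots> \<longleftrightarrow> switch (Suc p) (Suc s) (evac p Q) = evac s (switch (Suc p) (Suc s) (evac p G))"
    unfolding evac_decompose inj ..
  finally show ?thesis .
qed

lemma toggle_evac_interval_inner:
  assumes G: "G \<in> gt_patterns" and m: "0 < m" "Suc m < k" and l: "k < l"
  shows "toggle m (evac_interval k l G) = evac_interval k l (toggle m G)"
proof -
  obtain p s where ps: "k = Suc (Suc p)" "l = Suc (Suc (p + s))"
    using m l by (metis Suc_lessE less_imp_Suc_add add_Suc add_Suc_right less_imp_add_positive)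
  \<comment> \<open>\<open>R y x\<close> reads \<open>y = W^-1 q_s W x\<close>. The toggles 1 to
    \<open>p\<close> keep it, hence so does \<open>evac p\<close>, and conjugation by
    \<open>evac p\<close> turns it into \<open>y = q_[k,l] x\<close>.\<close>
  define R where "R y x \<longleftrightarrow> x \<in> gt_patterns \<and>
    switch (Suc p) (Suc s) y = evac s (switch (Suc p) (Suc s) x)" for y x
  have R: "R (toggle i y) (toggle i x)" if "0 < i" "i \<le> p" "R y x" for i y x
    using that toggle_switch_evac[of x i "Suc p" s y] by (auto simp: R_def toggle_gt_patterns)
  have "R (evac p (evac_interval k l G)) (evac p G)"
    using G evac_interval_conv_switch[of "evac_interval k l G" p s G]
    by (simp add: R_def evac_gt_patterns ps)
  then have "R (evac p (evac p (evac_interval k l G))) (evac p (evac p G))"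
    by (rule evac_rel[rotated]) (rule R)
  then have "R (toggle m (evac_interval k l G)) (toggle m G)"
    using R[of m] m ps by simp
  then have "R (evac p (toggle m (evac_interval k l G))) (evac p (toggle m G))"
    by (rule evac_rel[rotated]) (rule R)
  then show ?thesis
    unfolding evac_interval_conv_switch R_def ps by simp
qed

lemma evac_interval_commute:
  assumes "G \<in> gt_patterns" "1 \<le> i" "i < j" "j < k" "k < l"
  shows "evac_interval i j (evac_interval k l G) = evac_interval k l (evac_interval i j G)"
proof -
  define R where "R y x \<longleftrightarrow> x \<in> gt_patterns \<and> y = evac_interval k l x" for y x
  have "R (evac_interval i j (evac_interval k l G)) (evac_interval i j G)"
  proof (rule evac_interval_rel)
    fix a x y
    assume "0 < a" "a < j" "R x y"
    then show "R (toggle a x) (toggle a y)"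
      using toggle_evac_interval_inner[of y a k l] assms by (simp add: R_def toggle_gt_patterns)
  qed (use assms in \<open>auto simp: R_def\<close>)
  then show ?thesis by (simp add: R_def)
qed

section \<open>Bender-Knuth moves as toggles\<close>

definition gt_of :: "tableau \<Rightarrow> pattern" where
  "gt_of T i r = int (card {c. 0 < T r c \<and> T r c \<le> i})"

text \<open>Unlike \<open>gt_of\<close>, this can be verified for a filling not yet known to be
  semistandard, such as the result of a Bender-Knuth move.\<close>

definition represents :: "pattern \<Rightarrow> tableau \<Rightarrow> bool" where
  "represents G T \<longleftrightarrow> (\<forall>r c i. 0 < T r c \<and> T r c \<le> i \<longleftrightarrow> int c < G i r)"

lemma finite_initial_segment:
  fixes A :: "nat set"
  assumes "finite A" "\<And>x y. x < y \<Longrightarrow> y \<in> A \<Longrightarrow> x \<in> A"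
  shows "x \<in> A \<longleftrightarrow> x < card A"
proof (cases "A = {}")
  case False
  have max: "Max A \<in> A" "\<And>y. y \<in> A \<Longrightarrow> y \<le> Max A"
    using assms(1) False by auto
  then have "A = {..Max A}"
    using assms(2)[of _ "Max A"] by (auto simp: le_less)
  then have "card A = Suc (Max A)" "x \<in> A \<longleftrightarrow> x \<le> Max A"
    by (metis card_atMost, blast)
  then show ?thesis by auto
qed simp

lemma SSYT_I:
  assumes row: "\<And>r c c'. c < c' \<Longrightarrow> 0 < T r c' \<Longrightarrow> 0 < T r c \<and> T r c \<le> T r c'"
    and col: "\<And>r r' c. r < r' \<Longrightarrow> 0 < T r' c \<Longrightarrow> 0 < T r c \<and> T r c < T r' c"
    and fin: "finite {r. 0 < T r 0}" "\<And>r. finite {c. 0 < T r c}"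
  shows "T \<in> SSYT"
proof -
  define len where "len r = card {c. 0 < T r c}" for r
  define lam where "lam = map len [0..<card {r. 0 < T r 0}]"
  have len: "0 < T r c \<longleftrightarrow> c < len r" for r c
    using finite_initial_segment[OF fin(2)[of r], of c] row[of _ _ r] unfolding len_def by blast
  have rows: "0 < T r 0 \<longleftrightarrow> r < card {r. 0 < T r 0}" for r
    using finite_initial_segment[OF fin(1), of r] col[of _ _ 0] by blast
  have diagram: "(r, c) \<in> young_diagram lam \<longleftrightarrow> 0 < T r c" for r c
  proof -
    have "0 < T r c \<Longrightarrow> 0 < T r 0"
      using row[of 0 c r] by (cases "c = 0") auto
    then show ?thesis
      using rows[of r] len[of r c] by (auto simp: young_diagram_def lam_def)
  qed
  have "is_partition lam"
  proof -
    have "len r' \<le> len r" if "r < r'" for r r'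
      using col[OF that] len by (meson linorder_not_less order_less_irrefl)
    moreover have "len r \<noteq> 0" if "r < card {r. 0 < T r 0}" for r
      using that rows[of r] len[of r 0] by auto
    then have "0 \<notin> set lam"
      unfolding lam_def by fastforce
    ultimately show ?thesis
      by (auto simp: is_partition_def lam_def sorted_wrt_iff_nth_less)
  qed
  moreover have "ssyt_of_shape lam T"
    unfolding ssyt_of_shape_def diagram
  proof (intro conjI allI impI)
    show "T r c = 0" if "\<not> 0 < T r c" for r c
      using that by simp
    show "T r c \<le> T r c'" if "c < c' \<and> 0 < T r c'" for r c c'
      using row that by blast
    show "T r c < T r' c" if "r < r' \<and> 0 < T r' c" for r r' c
      using col that by blast
  qed
  ultimately show ?thesis
    unfolding SSYT_def by blast
qed

lemma SSYT_D:
  assumes "T \<in> SSYT"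
  shows "c < c' \<Longrightarrow> 0 < T r c' \<Longrightarrow> 0 < T r c \<and> T r c \<le> T r c'"
    and "r < r' \<Longrightarrow> 0 < T r' c \<Longrightarrow> 0 < T r c \<and> T r c < T r' c"
    and "finite {r. 0 < T r 0}" "finite {c. 0 < T r c}"
proof -
  obtain lam where lam: "is_partition lam" "ssyt_of_shape lam T"
    using assms unfolding SSYT_def by blast
  have pos: "0 < T r c \<longleftrightarrow> r < length lam \<and> c < lam ! r" for r c
    using lam(2) unfolding ssyt_of_shape_def young_diagram_def by (metis (mono_tags, lifting) case_prodI case_prodD less_irrefl mem_Collect_eq)
  have anti: "lam ! r' \<le> lam ! r" if "r < r'" "r' < length lam" for r r'
    using lam(1) that by (auto simp: is_partition_def sorted_wrt_iff_nth_less)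
  show "c < c' \<Longrightarrow> 0 < T r c' \<Longrightarrow> 0 < T r c \<and> T r c \<le> T r c'"
    using lam(2) pos[of r c] pos[of r c'] unfolding ssyt_of_shape_def young_diagram_def by auto
  show "r < r' \<Longrightarrow> 0 < T r' c \<Longrightarrow> 0 < T r c \<and> T r c < T r' c"
    using lam(2) pos[of r c] pos[of r' c] anti[of r r'] unfolding ssyt_of_shape_def young_diagram_def by auto
  show "finite {r. 0 < T r 0}"
    by (rule finite_subset[of _ "{..<length lam}"]) (auto simp: pos)
  show "finite {c. 0 < T r c}"
    by (rule finite_subset[of _ "{..<lam ! r}"]) (auto simp: pos)
qed

lemma represents_gt_of:
  assumes "T \<in> SSYT"
  shows "represents (gt_of T) T"
  unfolding represents_def
proof (intro allI)
  fix r c i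
  let ?A = "{c. 0 < T r c \<and> T r c \<le> i}"
  have "finite ?A"
    by (rule finite_subset[OF _ SSYT_D(4)[OF assms, of r]]) auto
  moreover have "x \<in> ?A" if "x < y" "y \<in> ?A" for x y
    using SSYT_D(1)[OF assms that(1), of r] that(2) by auto
  ultimately have "c \<in> ?A \<longleftrightarrow> c < card ?A"
    by (rule finite_initial_segment)
  then show "0 < T r c \<and> T r c \<le> i \<longleftrightarrow> int c < gt_of T i r"
    by (simp add: gt_of_def)
qed

lemma gt_of_unique:
  assumes "represents G T" "\<And>i r. 0 \<le> G i r"
  shows "gt_of T = G"
proof (intro ext)
  fix i r
  have "{c. 0 < T r c \<and> T r c \<le> i} = {..<nat (G i r)}"
    using assms(1) unfolding represents_def by auto
  then show "gt_of T i r = G i r"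
    using assms(2) by (simp add: gt_of_def)
qed

lemma gt_of_gt_patterns:
  assumes "T \<in> SSYT"
  shows "gt_of T \<in> gt_patterns"
proof -
  note T = SSYT_D[OF assms]
  have fin: "finite {c. 0 < T r c \<and> T r c \<le> i}" for r i
    by (rule finite_subset[OF _ T(4)[of r]]) auto
  \<comment> \<open>Rows count from 0 and columns increase strictly, so entries at most
    \<open>i\<close> occur only in the rows before \<open>i\<close>.\<close>
  have large: "r < T r c" if "0 < T r c" for r c
    using that
  proof (induction r)
    case (Suc r)
    then show ?case using T(2)[of r "Suc r" c] by auto
  qed
  have "gt_of T i r = 0" if "i \<le> r" for i r
  proof -
    have "{c. 0 < T r c \<and> T r c \<le> i} = {}"
      using large[of r] that by (metis (mono_tags, lifting) empty_Collect_eq leD order.trans)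
    then show ?thesis
      unfolding gt_of_def by (metis card.empty of_nat_0)
  qed
  moreover have "gt_of T i r \<le> gt_of T (Suc i) r" for i r
    unfolding gt_of_def by (auto intro!: card_mono fin)
  moreover have "gt_of T (Suc i) (Suc r) \<le> gt_of T i r" for i r
  proof -
    have "{c. 0 < T (Suc r) c \<and> T (Suc r) c \<le> Suc i} \<subseteq> {c. 0 < T r c \<and> T r c \<le> i}"
    proof
      fix c assume "c \<in> {c. 0 < T (Suc r) c \<and> T (Suc r) c \<le> Suc i}"
      then show "c \<in> {c. 0 < T r c \<and> T r c \<le> i}"
        using T(2)[of r "Suc r" c] by auto
    qed
    then show ?thesis
      using card_mono[OF fin] by (simp add: gt_of_def)
  qed
  ultimately show ?thesis by (auto simp: gt_patterns_def)
qed

lemma gt_of_inject: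
  assumes "T \<in> SSYT" "T' \<in> SSYT" "gt_of T = gt_of T'"
  shows "T = T'"
proof (intro ext)
  fix r c
  have "0 < T r c \<and> T r c \<le> i \<longleftrightarrow> 0 < T' r c \<and> T' r c \<le> i" for i
    using represents_gt_of[OF assms(1)] represents_gt_of[OF assms(2)] assms(3)
    unfolding represents_def by simp
  from this[of "T r c"] this[of "T' r c"] show "T r c = T' r c" by force
qed

lemma gt_patterns_antimono_row:
  assumes "G \<in> gt_patterns" "r \<le> r'"
  shows "G i r' \<le> G i r"
  using assms(2)
proof (induction r' rule: dec_induct)
  case (step n)
  have "G i (Suc n) \<le> G i n"
    using gt_patternsD(2)[OF assms(1), of i "Suc n"] gt_patternsD(3)[OF assms(1), of i n] by simp
  then show ?case using step by simp
qed simp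

text \<open>\<open>free_start\<close> and \<open>free_end\<close> are the ends of the interval in
  which the toggle reflects \<open>G i r\<close>. They also delimit the free boxes: an
  \<open>i\<close> has an \<open>i + 1\<close> below it in the columns before
  \<open>G (i + 1) (r + 1)\<close>, and an \<open>i + 1\<close> has an \<open>i\<close> above it
  from column \<open>G (i - 1) (r - 1)\<close> on.\<close>

definition free_start :: "nat \<Rightarrow> pattern \<Rightarrow> nat \<Rightarrow> int" where
  "free_start i G r = max (G (i - 1) r) (G (Suc i) (Suc r))"

definition free_end :: "nat \<Rightarrow> pattern \<Rightarrow> nat \<Rightarrow> int" where
  "free_end i G r = (case r of 0 \<Rightarrow> G (Suc i) 0 | Suc s \<Rightarrow> min (G (Suc i) r) (G (i - 1) s))"

lemma toggle_conv_free:
  "toggle i G i r = free_start i G r + free_end i G r - G i r"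
  by (simp add: toggle_def toggle_row_def free_start_def free_end_def max.commute split: nat.split)

lemma free_bounds:
  assumes "G \<in> gt_patterns" "0 < i"
  shows "0 \<le> free_start i G r" "free_start i G r \<le> G i r" "G i r \<le> free_end i G r"
  using gt_patternsD(2,3)[OF assms(1), of "i - 1"] gt_patternsD(2,3)[OF assms(1), of i] assms(2)
    gt_patterns_nonneg[OF assms(1), of "i - 1" r]
  by (auto simp: free_start_def free_end_def split: nat.split)

lemma entry_conv:
  assumes "represents G T" "0 < i"
  shows "T r c \<in> {i, i + 1} \<longleftrightarrow> G (i - 1) r \<le> int c \<and> int c < G (Suc i) r"
    and "T r c = i + 1 \<longleftrightarrow> G i r \<le> int c \<and> int c < G (Suc i) r"
proof -
  have 1: "0 < T r c \<and> T r c \<le> j \<longleftrightarrow> int c < G j r" for j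
    using assms(1) unfolding represents_def by blast
  show "T r c \<in> {i, i + 1} \<longleftrightarrow> G (i - 1) r \<le> int c \<and> int c < G (Suc i) r"
    unfolding 1[symmetric] not_less[symmetric] using assms(2) by auto
  show "T r c = i + 1 \<longleftrightarrow> G i r \<le> int c \<and> int c < G (Suc i) r"
    unfolding 1[symmetric] not_less[symmetric] using assms(2) by auto
qed

text \<open>Being free refers to the whole column, but the rows of a pattern decrease weakly, so the
  two adjacent rows of the tableau decide.\<close>

lemma free_box_conv:
  assumes G: "G \<in> gt_patterns" and T: "represents G T" and i: "0 < i"
  shows "free_box i T r c \<longleftrightarrow> free_start i G r \<le> int c \<and> int c < free_end i G r"
proof
  assume "free_box i T r c"
  then have in_row: "G (i - 1) r \<le> int c" "int c < G (Suc i) r"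
    and other: "\<And>r'. r' \<noteq> r \<Longrightarrow> int c < G (i - 1) r' \<or> G (Suc i) r' \<le> int c"
    unfolding free_box_def entry_conv(1)[OF T i] by force+
  have "G (Suc i) (Suc r) \<le> int c"
    using other[of "Suc r"] gt_patterns_antimono_row[OF G, of r "Suc r" "i - 1"] in_row by auto
  moreover have "int c < G (i - 1) s" if "r = Suc s" for s
    using other[of s] gt_patterns_antimono_row[OF G, of s r "Suc i"] in_row that by auto
  ultimately show "free_start i G r \<le> int c \<and> int c < free_end i G r"
    using in_row by (auto simp: free_start_def free_end_def split: nat.split)
next
  assume "free_start i G r \<le> int c \<and> int c < free_end i G r"
  then have in_row: "G (i - 1) r \<le> int c" "int c < G (Suc i) r" "G (Suc i) (Suc r) \<le> int c"
    and above: "\<And>s. r = Suc s \<Longrightarrow> int c < G (i - 1) s"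
    by (auto simp: free_start_def free_end_def split: nat.splits)
  have "int c < G (i - 1) r' \<or> G (Suc i) r' \<le> int c" if "r' \<noteq> r" for r'
  proof (cases "r' < r")
    case True
    then obtain s where "r = Suc s" "r' \<le> s" by (cases r) auto
    then show ?thesis
      using above[of s] gt_patterns_antimono_row[OF G, of r' s "i - 1"] by auto
  next
    case False
    then show ?thesis
      using in_row(3) gt_patterns_antimono_row[OF G, of "Suc r" r' "Suc i"] that by auto
  qed
  then show "free_box i T r c"
    unfolding free_box_def entry_conv(1)[OF T i] using in_row by force
qed

text \<open>A row has \<open>hi - G i r\<close> free entries \<open>i + 1\<close>, so the move
  shifts the boundary between the free entries from column \<open>G i r\<close> to
  \<open>lo + hi - G i r\<close>, its mirror image between \<open>lo\<close> and
  \<open>hi\<close>.\<close>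

lemma represents_bender_knuth:
  assumes G: "G \<in> gt_patterns" and T: "represents G T" and i: "0 < i"
  shows "represents (toggle i G) (bender_knuth i T)"
  unfolding represents_def
proof (intro allI)
  fix r c j
  define lo hi where "lo = free_start i G r" and "hi = free_end i G r"
  note bounds = free_bounds[OF G i, of r, folded lo_def hi_def]
  have free: "free_box i T r c \<longleftrightarrow> lo \<le> int c \<and> int c < hi" for c
    using free_box_conv[OF G T i] by (simp add: lo_def hi_def)
  have T': "0 < T r c \<and> T r c \<le> j \<longleftrightarrow> int c < G j r" for j
    using T unfolding represents_def by blast
  show "0 < bender_knuth i T r c \<and> bender_knuth i T r c \<le> j \<longleftrightarrow> int c < toggle i G j r"
  proof (cases "free_box i T r c")
    case True
    have "{c'. c' < c \<and> free_box i T r c'} = {nat lo..<c}"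
      using True bounds unfolding free by auto
    moreover have "{c'. free_box i T r c' \<and> T r c' = i + 1} = {nat (G i r)..<nat hi}"
    proof -
      have "hi \<le> G (Suc i) r"
        by (auto simp: hi_def free_end_def split: nat.split)
      then show ?thesis
        using bounds unfolding free entry_conv(2)[OF T i] by auto
    qed
    ultimately have "bender_knuth i T r c = (if int c < lo + hi - G i r then i else i + 1)"
      using True bounds unfolding bender_knuth_def free by (auto simp: nat_less_iff)
    moreover have "T r c \<in> {i, i + 1}"
      using True by (simp add: free_box_def)
    ultimately show ?thesis
      using toggle_conv_free[of i G r] T'[of j] i
      by (cases "j = i") (auto simp: lo_def hi_def toggle_other split: if_splits)
  next
    case False
    then have "bender_knuth i T r c = T r c"
      by (simp add: bender_knuth_def)
    \<comment> \<open>Old and new boundary both lie between \<open>lo\<close> and \<open>hi\<close>,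
      so a box outside the free range is on the same side of both.\<close>
    moreover have "int c < lo + hi - G i r \<longleftrightarrow> int c < G i r"
      using False bounds unfolding free by auto
    ultimately show ?thesis
      using T'[of j] toggle_conv_free[of i G r]
      by (cases "j = i") (auto simp: lo_def hi_def toggle_other)
  qed
qed

text \<open>Interlacing gives strict columns one row at a time. Finiteness of the shape does not
  follow from the pattern and is taken from \<open>T\<close>.\<close>

lemma SSYT_represents:
  assumes T: "T \<in> SSYT" and G: "G \<in> gt_patterns" "represents G T'"
    and shape: "\<And>r c. 0 < T' r c \<longleftrightarrow> 0 < T r c"
  shows "T' \<in> SSYT"
proof (rule SSYT_I)
  have T': "0 < T' r c \<and> T' r c \<le> j \<longleftrightarrow> int c < G j r" for r c j
    using G(2) unfolding represents_def by blast
  show "0 < T' r c \<and> T' r c \<le> T' r c'" if "c < c'" "0 < T' r c'" for r c c'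
    using that T'[of r c' "T' r c'"] T'[of r c "T' r c'"] by auto
  show "0 < T' r c \<and> T' r c < T' r' c" if "r < r'" "0 < T' r' c" for r r' c
    using that
  proof (induction r' rule: less_induct)
    case (less r')
    obtain s where "r' = Suc s"
      using less.prems(1) by (cases r') auto
    moreover obtain k where "T' r' c = Suc k"
      using less.prems(2) by (cases "T' r' c") auto
    ultimately have s: "r' = Suc s" "T' r' c = Suc k" .
    then have "int c < G (Suc k) (Suc s)"
      using T'[of r' c "Suc k"] by auto
    then have "int c < G k s"
      using gt_patternsD(3)[OF G(1), of k s] by simp
    then have "0 < T' s c" "T' s c \<le> k"
      using T'[of s c k] by auto
    then show ?case
      using less.IH[of s] less.prems(1) s by (cases "r = s") auto
  qed
  show "finite {r. 0 < T' r 0}" "\<And>r. finite {c. 0 < T' r c}"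
    using SSYT_D(3,4)[OF T] by (auto simp: shape)
qed

lemma bender_knuth_SSYT:
  assumes "T \<in> SSYT" "0 < i"
  shows "bender_knuth i T \<in> SSYT" and "gt_of (bender_knuth i T) = toggle i (gt_of T)"
proof -
  have rep: "represents (toggle i (gt_of T)) (bender_knuth i T)"
    using represents_bender_knuth gt_of_gt_patterns represents_gt_of assms by blast
  have gt: "toggle i (gt_of T) \<in> gt_patterns"
    using toggle_gt_patterns gt_of_gt_patterns assms by blast
  show "bender_knuth i T \<in> SSYT"
    by (rule SSYT_represents[OF assms(1) gt rep])
      (use assms(2) in \<open>auto simp: bender_knuth_def free_box_def\<close>)
  show "gt_of (bender_knuth i T) = toggle i (gt_of T)"
    using gt_of_unique[OF rep] gt_patterns_nonneg[OF gt] by blast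
qed

section \<open>Presented groups\<close>

lemma word_cong_words: "(u, v) \<in> word_cong X R \<Longrightarrow> u \<in> words X \<and> v \<in> words X"
  by (induction rule: word_cong.induct) (auto simp: words_def)

lemma equiv_word_cong: "equiv (words X) (word_cong X R)"
proof (rule equivI)
  show "word_cong X R \<subseteq> words X \<times> words X"
    by (auto dest: word_cong_words)
  show "refl_on (words X) (word_cong X R)"
    by (auto simp: refl_on_def intro: word_cong.refl)
  show "sym (word_cong X R)"
    by (rule symI) (rule word_cong.sym)
  show "trans (word_cong X R)"
    by (rule transI) (rule word_cong.trans)
qed

lemma append_words [simp]: "u @ v \<in> words X \<longleftrightarrow> u \<in> words X \<and> v \<in> words X"
  by (auto simp: words_def)

lemma word_cong_context:
  "(u, v) \<in> word_cong X R \<Longrightarrow> a \<in> words X \<Longrightarrow> b \<in> words X \<Longrightarrow> (a @ u @ b, a @ v @ b) \<in> word_cong X R"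
proof (induction rule: word_cong.induct)
  case (refl u)
  then show ?case by (simp add: word_cong.refl)
next
  case (sym u v)
  then show ?case by (simp only: word_cong.sym[of "a @ u @ b" "a @ v @ b"])
next
  case (trans u v w)
  then show ?case by (simp only: word_cong.trans[of "a @ u @ b" "a @ v @ b"])
next
  case (cancel u v x c)
  then show ?case
    using word_cong.cancel[of "a @ u" X "v @ b" x c R] by simp
next
  case (relation u v l r)
  then show ?case
    using word_cong.relation[of "a @ u" X "v @ b" l r R] by simp
qed

lemma word_cong_append:
  assumes "(u, u') \<in> word_cong X R" "(v, v') \<in> word_cong X R"
  shows "(u @ v, u' @ v') \<in> word_cong X R"
proof (rule word_cong.trans)
  show "(u @ v, u' @ v) \<in> word_cong X R"
    using word_cong_context[OF assms(1), of "[]" v] word_cong_words[OF assms(2)] by (simp add: words_def)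
  show "(u' @ v, u' @ v') \<in> word_cong X R"
    using word_cong_context[OF assms(2), of u' "[]"] word_cong_words[OF assms(1)] by (simp add: words_def)
qed

lemma presented_group_mult:
  assumes "u \<in> words X" "v \<in> words X"
  shows "word_cong X R `` {u} \<otimes>\<^bsub>presented_group X R\<^esub> word_cong X R `` {v} = word_cong X R `` {u @ v}"
proof -
  have "congruent2 (word_cong X R) (word_cong X R) (\<lambda>u v. word_cong X R `` {u @ v})"
    by (intro congruent2I' equiv_class_eq[OF equiv_word_cong] word_cong_append)
  from UN_equiv_class2[OF equiv_word_cong equiv_word_cong this assms] show ?thesis
    by (simp add: presented_group_def)
qed

lemma presented_group_carrier:
  "carrier (presented_group X R) = (\<lambda>u. word_cong X R `` {u}) ` words X"
  by (auto simp: presented_group_def quotient_def)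

lemma presented_group_one: "\<one>\<^bsub>presented_group X R\<^esub> = word_cong X R `` {[]}"
  by (simp add: presented_group_def)

lemma Nil_words [simp]: "[] \<in> words X"
  by (simp add: words_def)

lemma Cons_words [simp]: "y # u \<in> words X \<longleftrightarrow> fst y \<in> X \<and> u \<in> words X"
  by (cases y) (auto simp: words_def)

lemma word_cong_left_inverse:
  "u \<in> words X \<Longrightarrow> \<exists>v \<in> words X. (v @ u, []) \<in> word_cong X R"
proof (induction u)
  case Nil
  show ?case by (intro bexI[of _ "[]"]) (auto intro: word_cong.refl)
next
  case (Cons y u)
  obtain x b where y: "y = (x, b)" by (cases y)
  obtain v where v: "v \<in> words X" "(v @ u, []) \<in> word_cong X R"
    using Cons by auto
  have "(v @ [(x, \<not> b), (x, b)] @ u, v @ u) \<in> word_cong X R"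
    using word_cong.cancel[of v X u x "\<not> b" R] v Cons.prems y by simp
  from word_cong.trans[OF this v(2)] have "((v @ [(x, \<not> b)]) @ y # u, []) \<in> word_cong X R"
    by (simp add: y)
  then show ?case
    using v Cons.prems y by (intro bexI[of _ "v @ [(x, \<not> b)]"]) auto
qed

lemma group_presented_group: "group (presented_group X R)"
proof (rule groupI)
  fix A assume "A \<in> carrier (presented_group X R)"
  then obtain u where u: "u \<in> words X" "A = word_cong X R `` {u}"
    by (auto simp: presented_group_carrier)
  obtain v where v: "v \<in> words X" "(v @ u, []) \<in> word_cong X R"
    using word_cong_left_inverse[OF u(1)] by blast
  have "word_cong X R `` {v} \<otimes>\<^bsub>presented_group X R\<^esub> A = \<one>\<^bsub>presented_group X R\<^esub>"
    using equiv_class_eq[OF equiv_word_cong v(2)] u v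
    by (simp add: presented_group_mult presented_group_one)
  then show "\<exists>B\<in>carrier (presented_group X R). B \<otimes>\<^bsub>presented_group X R\<^esub> A = \<one>\<^bsub>presented_group X R\<^esub>"
    using v(1) by (auto simp: presented_group_carrier)
qed (auto simp: presented_group_carrier presented_group_mult presented_group_one)

primrec word_eval :: "('h, 'b) monoid_scheme \<Rightarrow> ('g \<Rightarrow> 'h) \<Rightarrow> 'g word \<Rightarrow> 'h" where
  "word_eval H f [] = \<one>\<^bsub>H\<^esub>"
| "word_eval H f (y # u) =
    (if snd y then f (fst y) else inv\<^bsub>H\<^esub> f (fst y)) \<otimes>\<^bsub>H\<^esub> word_eval H f u"

context
  fixes H :: "('h, 'b) monoid_scheme" and X :: "'g set" and f :: "'g \<Rightarrow> 'h"
  assumes H: "group H" and f: "\<And>x. x \<in> X \<Longrightarrow> f x \<in> carrier H"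
begin

interpretation H: group H by (rule H)

lemma word_eval_closed: "u \<in> words X \<Longrightarrow> word_eval H f u \<in> carrier H"
  by (induction u) (auto simp: f)

lemma word_eval_append:
  "u \<in> words X \<Longrightarrow> v \<in> words X \<Longrightarrow> word_eval H f (u @ v) = word_eval H f u \<otimes>\<^bsub>H\<^esub> word_eval H f v"
  by (induction u) (auto simp: f word_eval_closed H.m_assoc)

lemma word_eval_cong:
  assumes R: "\<And>l r. (l, r) \<in> R \<Longrightarrow> l \<in> words X \<Longrightarrow> r \<in> words X \<Longrightarrow> word_eval H f l = word_eval H f r"
  shows "(u, v) \<in> word_cong X R \<Longrightarrow> word_eval H f u = word_eval H f v"
proof (induction rule: word_cong.induct)
  case (cancel u v x b)
  then have "word_eval H f ([(x, b), (x, \<not> b)] @ v) = word_eval H f v"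
    using f word_eval_closed by (auto simp: H.m_assoc[symmetric])
  then show ?case
    using cancel by (simp only: word_eval_append append_words Cons_words Nil_words fst_conv)
next
  case (relation u v l r)
  then show ?case
    using R by (simp add: word_eval_append)
qed auto

text \<open>Von Dyck's theorem: evaluation of words respects the congruence, and the images of the
  generators determine the homomorphism. Extensionality fixes the values off the carrier, which
  makes it unique as a function.\<close>

lemma presented_group_universal:
  assumes R: "\<And>l r. (l, r) \<in> R \<Longrightarrow> l \<in> words X \<Longrightarrow> r \<in> words X \<Longrightarrow> word_eval H f l = word_eval H f r"
  shows "\<exists>!\<phi>. \<phi> \<in> extensional (carrier (presented_group X R)) \<and> group_hom (presented_group X R) H \<phi> \<and>
    (\<forall>x\<in>X. \<phi> (word_cong X R `` {[(x, True)]}) = f x)"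
proof (rule ex_ex1I)
  define \<phi> where "\<phi> = restrict (\<lambda>A. word_eval H f (SOME u. u \<in> A)) (carrier (presented_group X R))"
  have \<phi>: "\<phi> (word_cong X R `` {u}) = word_eval H f u" if "u \<in> words X" for u
  proof -
    have "(SOME v. v \<in> word_cong X R `` {u}) \<in> word_cong X R `` {u}"
      by (rule someI[of _ u]) (use that in \<open>auto intro: word_cong.refl\<close>)
    then have "word_eval H f u = word_eval H f (SOME v. v \<in> word_cong X R `` {u})"
      by (intro word_eval_cong[OF R]) auto
    then show ?thesis
      using that by (auto simp: \<phi>_def presented_group_carrier)
  qed
  have "\<phi> \<in> hom (presented_group X R) H"
    by (rule homI) (auto simp: presented_group_carrier presented_group_mult \<phi> word_eval_closed word_eval_append)
  then have "group_hom (presented_group X R) H \<phi>"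
    by (intro group_hom.intro group_presented_group H group_hom_axioms.intro)
  moreover have "\<phi> (word_cong X R `` {[(x, True)]}) = f x" if "x \<in> X" for x
    using that f by (simp add: \<phi>)
  ultimately show "\<exists>\<phi>. \<phi> \<in> extensional (carrier (presented_group X R)) \<and> group_hom (presented_group X R) H \<phi> \<and>
    (\<forall>x\<in>X. \<phi> (word_cong X R `` {[(x, True)]}) = f x)"
    by (intro exI[of _ \<phi>]) (auto simp: \<phi>_def)
next
  fix \<phi> \<psi>
  assume \<phi>: "\<phi> \<in> extensional (carrier (presented_group X R)) \<and> group_hom (presented_group X R) H \<phi> \<and>
      (\<forall>x\<in>X. \<phi> (word_cong X R `` {[(x, True)]}) = f x)"
    and \<psi>: "\<psi> \<in> extensional (carrier (presented_group X R)) \<and> group_hom (presented_group X R) H \<psi> \<and>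
      (\<forall>x\<in>X. \<psi> (word_cong X R `` {[(x, True)]}) = f x)"
  have eval: "\<chi> (word_cong X R `` {u}) = word_eval H f u"
    if hom: "group_hom (presented_group X R) H \<chi>"
      and gen: "\<And>x. x \<in> X \<Longrightarrow> \<chi> (word_cong X R `` {[(x, True)]}) = f x"
      and "u \<in> words X" for \<chi> u
  proof -
    interpret \<chi>: group_hom "presented_group X R" H \<chi> by (rule hom)
    \<comment> \<open>Inverse letters are separate symbols; that they go to inverses comes from the
      cancellation rule.\<close>
    have letter: "\<chi> (word_cong X R `` {[y]}) = (if snd y then f (fst y) else inv\<^bsub>H\<^esub> f (fst y))"
      if "fst y \<in> X" for y
    proof -
      obtain x b where y: "y = (x, b)" by (cases y)
      have x: "x \<in> X" using that y by simp
      have "word_cong X R `` {[(x, False)] @ [(x, True)]} = word_cong X R `` {[]}"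
        using equiv_class_eq[OF equiv_word_cong word_cong.cancel[of "[]" X "[]" x False R]] x by simp
      then have "\<chi> (word_cong X R `` {[(x, False)]}) \<otimes>\<^bsub>H\<^esub> f x = \<one>\<^bsub>H\<^esub>"
        using x gen[OF x] \<chi>.hom_mult[of "word_cong X R `` {[(x, False)]}" "word_cong X R `` {[(x, True)]}"] \<chi>.hom_one
        by (simp add: presented_group_carrier presented_group_mult presented_group_one)
      then have "\<chi> (word_cong X R `` {[(x, False)]}) = inv\<^bsub>H\<^esub> f x"
        using x f by (intro H.inv_equality[symmetric]) (auto simp: presented_group_carrier)
      then show ?thesis
        using y gen[OF x] by simp
    qed
    show ?thesis
      using \<open>u \<in> words X\<close>
    proof (induction u)
      case Nil
      then show ?case using \<chi>.hom_one by (simp add: presented_group_one)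
    next
      case (Cons y u)
      then have "\<chi> (word_cong X R `` {[y] @ u}) = \<chi> (word_cong X R `` {[y]}) \<otimes>\<^bsub>H\<^esub> \<chi> (word_cong X R `` {u})"
        by (subst presented_group_mult[symmetric]) (auto simp: presented_group_carrier)
      then show ?case
        using Cons letter by simp
    qed
  qed
  show "\<phi> = \<psi>"
  proof (rule extensionalityI)
    fix A assume "A \<in> carrier (presented_group X R)"
    then show "\<phi> A = \<psi> A"
      using eval[of \<phi>] eval[of \<psi>] \<phi> \<psi> by (auto simp: presented_group_carrier)
  qed (use \<phi> \<psi> in auto)
qed

end

section \<open>The cactus relations\<close>

text \<open>Patterns determine tableaux, so a permutation of \<open>SSYT\<close> is known from the
  map it induces on patterns. An identity of such maps on \<open>gt_patterns\<close> thus becomes an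
  identity in the group.\<close>

definition acts_as :: "(tableau \<Rightarrow> tableau) \<Rightarrow> (pattern \<Rightarrow> pattern) \<Rightarrow> bool" where
  "acts_as x F \<longleftrightarrow> x \<in> Bij SSYT \<and> (\<forall>T\<in>SSYT. gt_of (x T) = F (gt_of T))"

lemma mult_BK: "x \<in> Bij SSYT \<Longrightarrow> y \<in> Bij SSYT \<Longrightarrow> x \<otimes>\<^bsub>BK\<^esub> y = compose SSYT x y"
  by (simp add: BK_def BijGroup_def)

lemma acts_as_mult:
  assumes "acts_as x F" "acts_as y F'"
  shows "acts_as (x \<otimes>\<^bsub>BK\<^esub> y) (\<lambda>G. F (F' G))"
proof -
  have y: "y T \<in> SSYT" if "T \<in> SSYT" for T
    using Bij_imp_funcset[of y SSYT] assms(2) that unfolding acts_as_def by blast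
  show ?thesis
    using assms y by (auto simp: acts_as_def mult_BK compose_Bij compose_eq)
qed

lemma acts_as_one: "acts_as \<one>\<^bsub>BK\<^esub> (\<lambda>G. G)"
  by (simp add: acts_as_def BK_def BijGroup_def id_Bij)

lemma acts_as_bk_move:
  assumes "0 < i"
  shows "acts_as (bk_move i) (toggle i)"
proof -
  have "bender_knuth i (bender_knuth i T) = T" if "T \<in> SSYT" for T
    using that assms by (intro gt_of_inject) (auto simp: bender_knuth_SSYT)
  then have "bij_betw (bender_knuth i) SSYT SSYT"
    by (intro bij_betwI[of _ _ _ "bender_knuth i"]) (use assms in \<open>auto simp: bender_knuth_SSYT\<close>)
  then show ?thesis
    using assms by (simp add: acts_as_def bk_move_def Bij_def bender_knuth_SSYT cong: bij_betw_cong)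
qed

lemma acts_as_unique:
  assumes "acts_as x F" "acts_as y F'" "\<And>G. G \<in> gt_patterns \<Longrightarrow> F G = F' G"
  shows "x = y"
proof (rule extensionalityI)
  show "x \<in> extensional SSYT" "y \<in> extensional SSYT"
    using assms by (auto simp: acts_as_def Bij_imp_extensional)
  fix T assume T: "T \<in> SSYT"
  have "x T \<in> SSYT" "y T \<in> SSYT"
    using Bij_imp_funcset[of _ SSYT] assms T unfolding acts_as_def by blast+
  then show "x T = y T"
    using assms T by (intro gt_of_inject) (auto simp: acts_as_def gt_of_gt_patterns)
qed

lemma acts_as_bk_desc: "acts_as (bk_desc m) (promote m)"
proof (induction m)
  case 0
  then show ?case using acts_as_one by (simp add: promote_0[abs_def])
next
  case (Suc m)
  then show ?case
    using acts_as_mult[OF acts_as_bk_move Suc, of "Suc m"] by (simp add: promote_Suc[abs_def])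
qed

lemma acts_as_bk_q: "acts_as (bk_q m) (evac m)"
proof (induction m)
  case 0
  then show ?case using acts_as_one by (simp add: evac.simps(1)[abs_def])
next
  case (Suc m)
  then show ?case
    using acts_as_mult[OF Suc acts_as_bk_desc, of "Suc m"] by (simp add: evac.simps(2)[abs_def])
qed

lemma acts_as_bk_q_interval: "acts_as (bk_q_interval i j) (evac_interval i j)"
  unfolding bk_q_interval_def evac_interval_def[abs_def]
  by (rule acts_as_mult[OF acts_as_mult[OF acts_as_bk_q acts_as_bk_q] acts_as_bk_q])

lemma group_BK: "group BK"
  unfolding BK_def by (intro group.group_subgroup_generated group_BijGroup)

lemma group_BK_sub: "group (BK_sub n)"
  unfolding BK_sub_def by (intro group.group_subgroup_generated group_BK)

lemma BK_sub_mult: "x \<otimes>\<^bsub>BK_sub n\<^esub> y = x \<otimes>\<^bsub>BK\<^esub> y"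
  by (simp add: BK_sub_def)

lemma BK_sub_one: "\<one>\<^bsub>BK_sub n\<^esub> = \<one>\<^bsub>BK\<^esub>"
  by (simp add: BK_sub_def)

lemma bk_move_BK_sub:
  assumes "0 < i" "i < n"
  shows "bk_move i \<in> carrier (BK_sub n)"
proof -
  have "bk_move i \<in> carrier BK"
    using assms acts_as_bk_move[of i] unfolding BK_def carrier_subgroup_generated
    by (intro generate.incl) (auto simp: acts_as_def BijGroup_def)
  then show ?thesis
    using assms unfolding BK_sub_def carrier_subgroup_generated
    by (intro generate.incl) auto
qed

lemma bk_desc_BK_sub: "m < n \<Longrightarrow> bk_desc m \<in> carrier (BK_sub n)"
proof (induction m)
  case 0
  then show ?case
    using monoid.one_closed[OF group.is_monoid[OF group_BK_sub]] by (simp add: BK_sub_one)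
next
  case (Suc m)
  then show ?case
    using monoid.m_closed[OF group.is_monoid[OF group_BK_sub] bk_move_BK_sub[of "Suc m" n]]
    by (simp add: BK_sub_mult)
qed

lemma bk_q_BK_sub: "m < n \<Longrightarrow> bk_q m \<in> carrier (BK_sub n)"
proof (induction m)
  case 0
  then show ?case
    using bk_desc_BK_sub[of 0 n] by simp
next
  case (Suc m)
  then show ?case
    using monoid.m_closed[OF group.is_monoid[OF group_BK_sub], of "bk_q m" n "bk_desc (Suc m)"]
      bk_desc_BK_sub[of "Suc m" n]
    by (simp add: BK_sub_mult del: bk_desc.simps)
qed

lemma bk_q_interval_BK_sub:
  assumes "1 \<le> i" "i < j" "j \<le> n"
  shows "bk_q_interval i j \<in> carrier (BK_sub n)"
  unfolding bk_q_interval_def BK_sub_mult[of n, symmetric]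
  using assms by (intro monoid.m_closed[OF group.is_monoid[OF group_BK_sub]] bk_q_BK_sub) auto

lemma cactus_rels_hold:
  defines "f \<equiv> \<lambda>(i, j). bk_q_interval i j"
  assumes "(l, r) \<in> cactus_rels n"
  shows "word_eval (BK_sub n) f l = word_eval (BK_sub n) f r"
proof -
  interpret group "BK_sub n" by (rule group_BK_sub)
  have closed: "f (i, j) \<in> carrier (BK_sub n)" if "(i, j) \<in> cactus_gens n" for i j
    using that by (auto simp: f_def cactus_gens_def bk_q_interval_BK_sub)
  have f: "acts_as (f (i, j)) (evac_interval i j)" for i j
    by (simp add: f_def acts_as_bk_q_interval)
  note mult = acts_as_mult[folded BK_sub_mult[of n]]
  note one = acts_as_one[folded BK_sub_one[of n]]
  consider (square) i j where "(i, j) \<in> cactus_gens n" "l = cactus_letter i j @ cactus_letter i j" "r = []"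
    | (commute) i j k m where "(i, j) \<in> cactus_gens n" "(k, m) \<in> cactus_gens n" "j < k"
        "l = cactus_letter i j @ cactus_letter k m" "r = cactus_letter k m @ cactus_letter i j"
    | (conj) i j k m where "(i, j) \<in> cactus_gens n" "(k, m) \<in> cactus_gens n" "i \<le> k" "m \<le> j"
        "l = cactus_letter i j @ cactus_letter k m @ cactus_letter i j"
        "r = cactus_letter (i + j - m) (i + j - k)"
    using assms(2) unfolding cactus_rels_def by blast
  then show ?thesis
  proof cases
    case square
    have "f (i, j) \<otimes>\<^bsub>BK_sub n\<^esub> f (i, j) = \<one>\<^bsub>BK_sub n\<^esub>"
      by (rule acts_as_unique[OF mult[OF f f] one]) simp
    then show ?thesis
      using square closed by (simp add: cactus_letter_def)
  next
    case commute
    have "f (i, j) \<otimes>\<^bsub>BK_sub n\<^esub> f (k, m) = f (k, m) \<otimes>\<^bsub>BK_sub n\<^esub> f (i, j)"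
      by (rule acts_as_unique[OF mult[OF f f] mult[OF f f]])
        (use commute in \<open>auto simp: cactus_gens_def intro!: evac_interval_commute\<close>)
    then show ?thesis
      using commute closed by (simp add: cactus_letter_def)
  next
    case conj
    have "f (i, j) \<otimes>\<^bsub>BK_sub n\<^esub> (f (k, m) \<otimes>\<^bsub>BK_sub n\<^esub> f (i, j)) = f (i + j - m, i + j - k)"
      by (rule acts_as_unique[OF mult[OF f mult[OF f f]] f])
        (use conj in \<open>auto simp: cactus_gens_def intro!: evac_interval_conj\<close>)
    moreover have "(i + j - m, i + j - k) \<in> cactus_gens n"
      using conj by (auto simp: cactus_gens_def)
    ultimately show ?thesis
      using conj closed by (simp add: cactus_letter_def)
  qed
qed

theorem theorem1p4:
  fixes n :: nat
  assumes "n \<ge> 2"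
  shows "\<exists>!\<phi>. \<phi> \<in> extensional (carrier (cactus_group n)) \<and>
    group_hom (cactus_group n) (BK_sub n) \<phi> \<and>
    (\<forall>i j. 1 \<le> i \<and> i < j \<and> j \<le> n \<longrightarrow> \<phi> (cactus_q n i j) = bk_q_interval i j)"
proof -
  define f where "f = (\<lambda>(i, j). bk_q_interval i j)"
  have gens: "(\<forall>x\<in>cactus_gens n. \<phi> (word_cong (cactus_gens n) (cactus_rels n) `` {[(x, True)]}) = f x) \<longleftrightarrow>
      (\<forall>i j. 1 \<le> i \<and> i < j \<and> j \<le> n \<longrightarrow> \<phi> (cactus_q n i j) = bk_q_interval i j)"
    for \<phi> :: "(nat \<times> nat) word set \<Rightarrow> tableau \<Rightarrow> tableau"
    by (auto simp: f_def cactus_gens_def cactus_q_def cactus_letter_def)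
  show ?thesis
    unfolding cactus_group_def gens[symmetric]
  proof (rule presented_group_universal[OF group_BK_sub])
    show "f x \<in> carrier (BK_sub n)" if "x \<in> cactus_gens n" for x
      using that by (auto simp: f_def cactus_gens_def bk_q_interval_BK_sub)
    show "word_eval (BK_sub n) f l = word_eval (BK_sub n) f r" if "(l, r) \<in> cactus_rels n" for l r
      using cactus_rels_hold[OF that] by (simp add: f_def)
  qed
qed

end
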